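(* Let $\{\pi_k\}_{k\ge0}$ be the policy sequence generated by PMD with mirror map $h(p)=\sum_a\psi(p(a))$ and a constant step size $\eta>0$. Assume $\psi'(0^+)=-\infty$ and $\psi'(1^-)<+\infty$, and let $\pi_\infty=\lim_{k\to\infty}\pi_k$ be the limiting policy (which exists under these conditions). If $\psi$ is twice continuously differentiable on $\mathrm{int}\,\mathrm{dom}\,\psi$ and $0<\psi''(x)<+\infty$ for all $x\in\mathrm{int}\,\mathrm{dom}\,\psi$, then: (a) for any $s\in\mathcal S_{=1}$ and $\sigma\in(0,\Delta/2)$, $$\forall\,k\ge T_1(\sigma):\quad\|\pi_k(\cdot|s)-\pi_\infty(\cdot|s)\|_\infty\le b_s^{\pi_k}\le|\mathcal A|\cdot\varphi^{-1}\big(k\eta(\Delta-2\sigma)-C_1(\sigma)\big);$$ (b) for any $s\in\mathcal S_{>1}$ there are strictly positive finite constants $U_s$ and $L_s$, depending on the limiting policy $\pi_\infty(\cdot|s)$ and the second derivative $\psi''$, such that for any $\sigma\in(0,\Delta/2)$ there exists a finite iteration $T_3(\sigma)$ with $$\forall\,k\ge T_3(\sigma):\quad\|\pi_k(\cdot|s)-\pi_\infty(\cdot|s)\|_\infty\le\frac{U_s}{L_s}\,b_s^{\pi_k}+\frac{2\eta U_s}{L_s^2}\sum_{t=k}^\infty\|V^*-V^{\pi_t}\|_\infty.$$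
   Context: MDP: $(\mathcal S,\mathcal A,P,r,\gamma)$ is a finite discounted Markov decision process: finite state space $\mathcal S$, finite action space $\mathcal A$, transition model $P(\cdot|s,a)\in\Delta(\mathcal S)$, reward $r:\mathcal S\times\mathcal A\to[0,1]$, discount $\gamma\in[0,1)$. $\Delta(\mathcal X)$ is the probability simplex over a finite set $\mathcal X$. A policy $\pi$ assigns to each $s$ a distribution $\pi(\cdot|s)\in\Delta(\mathcal A)$; $\Pi$ is the set of all policies. $V^\pi(s)$ is the expected value of $\sum_{t\ge0}\gamma^t r(s_t,a_t)$ given $s_0=s$, $a_t\sim\pi(\cdot|s_t)$, $s_{t+1}\sim P(\cdot|s_t,a_t)$, and $Q^\pi(s,a)$ is the same conditioned on $(s_0,a_0)=(s,a)$. $V^*(s)=\max_{\pi\in\Pi}V^\pi(s)$, $Q^*(s,a)=\max_{\pi\in\Pi}Q^\pi(s,a)$. $\mathcal A^*_s=\{a: Q^*(s,a)=V^*(s)\}$, $\mathcal S_{=1}=\{s:|\mathcal A_s^*|=1\}$, $\mathcal S_{>1}=\{s:|\mathcal A_s^*|>1\}$, $\tilde{\mathcal S}=\{s:\mathcal A_s^*\ne\mathcal A\}$, the last assumed nonempty throughout. For $s\in\tilde{\mathcal S}$, $\Delta_s=V^*(s)-\max_{a'\notin\mathcal A_s^*}Q^*(s,a')$, and $\Delta=\min_{s\in\tilde{\mathcal S}}\Delta_s>0$ (a number; not to be confused with the simplex $\Delta(\cdot)$). $b_s^\pi=\sum_{a'\notin\mathcal A_s^*}\pi(a'|s)$. Mirror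 map: $\psi:\mathbb R\to(-\infty,+\infty]$ satisfies: (a) $\mathrm{dom}\,\psi\supseteq[0,1]$; (b) $\psi$ is proper, closed and convex; (c) $\psi$ is differentiable on $\mathrm{int}\,\mathrm{dom}\,\psi$ and $|\psi'(x_n)|\to\infty$ for every sequence $\{x_n\}\subseteq\mathrm{int}\,\mathrm{dom}\,\psi$ converging to a boundary point of $\mathrm{dom}\,\psi$; (d) $\psi$ is strictly convex on $\mathrm{int}\,\mathrm{dom}\,\psi$. $\psi'(0^+)$ and $\psi'(1^-)$ are the one-sided limits of $\psi'$ at $0$ from the right and at $1$ from the left. $h(p)=\sum_{a\in\mathcal A}\psi(p(a))$ and $D_h(p\|q)=h(p)-h(q)-\langle\nabla h(q),p-q\rangle$. PMD: given $\eta>0$ and an initial policy $\pi_0$ with $\pi_0(a|s)\in\mathrm{int}\,\mathrm{dom}\,\psi$ for all $(s,a)$ (assumed throughout), for each $s$, $\pi_{k+1}(\cdot|s)=\arg\max_{p\in\Delta(\mathcal A)}\{\eta\langle p,Q^{\pi_k}(s,\cdot)\rangle-D_h(p\|\pi_k(\cdot|s))\}$; all iterates satisfy $\pi_k(a|s)\in\mathrm{int}\,\mathrm{dom}\,\psi$. Constants: $\varphi(x):=-\psi'(x)$ is a continuous strictly decreasing map of $(0,1]$ onto $[-\psi'(1^-),+\infty)$ with inverse $\varphi^{-1}$. $T(\sigma):=\min\{k:\|V^*-V^{\pi_k}\|_\infty\le\sigma\}$ (finite). For $s\in\tilde{\mathcal S}$, $G_k(s):=\min_{a^*\in\mathcal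 A_s^*}\psi'(\pi_k(a^*|s))-\max_{a'\notin\mathcal A_s^*}\psi'(\pi_k(a'|s))$, $C_s(\sigma):=\psi'(1^-)-G_{T(\sigma)}(s)+\eta(\Delta-2\sigma)T(\sigma)$, and $C_1(\sigma):=\max_{s\in\tilde{\mathcal S}}C_s(\sigma)$. $T_1(\sigma)\ge T(\sigma)$ is an integer large enough that $k\eta(\Delta-2\sigma)-C_s(\sigma)\ge-\psi'(1^-)$ for all $k\ge T_1(\sigma)$ and all $s\in\tilde{\mathcal S}$. *)

theory Defs
  imports "HOL-Probability.Probability"
begin

section \<open>Finite discounted Markov decision processes\<close>

record ('s, 'a) mdp =
  trans :: "'s \<Rightarrow> 'a \<Rightarrow> 's pmf"
  reward :: "'s \<Rightarrow> 'a \<Rightarrow> real"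
  discount :: real

definition valid_mdp :: "('s::finite, 'a::finite) mdp \<Rightarrow> bool" where
  "valid_mdp M \<longleftrightarrow> (\<forall>s a. 0 \<le> reward M s a \<and> reward M s a \<le> 1) \<and> 0 \<le> discount M \<and> discount M < 1"

type_synonym ('s, 'a) policy = "'s \<Rightarrow> 'a pmf"

text \<open>The conditional law of \<open>(s\<^sub>n, a\<^sub>n)\<close> given the history \<open>\<omega> 0, \<dots>, \<omega> (n - 1)\<close>, where
  \<open>\<mu>\<close> is the law of \<open>(s\<^sub>0, a\<^sub>0)\<close>.\<close>

definition traj_kernel ::
  "('s, 'a) mdp \<Rightarrow> ('s, 'a) policy \<Rightarrow> ('s \<times> 'a) pmf \<Rightarrow> nat \<Rightarrow> (nat \<Rightarrow> 's \<times> 'a) \<Rightarrow> ('s \<times> 'a) pmf" where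
  "traj_kernel M \<pi> \<mu> n \<omega> =
     (case n of
        0 \<Rightarrow> \<mu>
      | Suc m \<Rightarrow> bind_pmf (trans M (fst (\<omega> m)) (snd (\<omega> m))) (\<lambda>s'. map_pmf (Pair s') (\<pi> s')))"

text \<open>The law of the whole trajectory \<open>(s\<^sub>t, a\<^sub>t)\<close>, \<open>t = 0, 1, 2, \<dots>\<close>, obtained from these kernels by
  the Ionescu-Tulcea extension theorem.\<close>

definition traj_law ::
  "('s, 'a) mdp \<Rightarrow> ('s, 'a) policy \<Rightarrow> ('s \<times> 'a) pmf \<Rightarrow> (nat \<Rightarrow> 's \<times> 'a) measure" where
  "traj_law M \<pi> \<mu> =
     projective_family.lim UNIV
       (Ionescu_Tulcea.CI (\<lambda>n \<omega>. measure_pmf (traj_kernel M \<pi> \<mu> n \<omega>)) (\<lambda>_. count_space UNIV))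
       (\<lambda>_. count_space UNIV)"

definition discounted_return :: "('s, 'a) mdp \<Rightarrow> (nat \<Rightarrow> 's \<times> 'a) \<Rightarrow> real" where
  "discounted_return M \<omega> = (\<Sum>t. discount M ^ t * reward M (fst (\<omega> t)) (snd (\<omega> t)))"

text \<open>The kernels satisfy the hypotheses of the extension theorem, and the coordinates of
  \<open>traj_law\<close> have the expected Markovian laws.\<close>

lemma Ionescu_Tulcea_traj_kernel: "Ionescu_Tulcea (\<lambda>n \<omega>. measure_pmf (traj_kernel (M :: ('s::finite,'a::finite) mdp) \<pi> \<mu> n \<omega>)) (\<lambda>_. count_space UNIV)"
proof
  fix i 
  show "(\<lambda>\<omega>. measure_pmf (traj_kernel M \<pi> \<mu> i \<omega>)) \<in> PiM {0..<i} (\<lambda>_. count_space UNIV) \<rightarrow>\<^sub>M subprob_algebra (count_space UNIV)"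
  proof (cases i)
    case 0 then show ?thesis
      by (auto simp: traj_kernel_def space_subprob_algebra intro!: measurable_const measure_pmf.subprob_space_axioms)
  next
    case (Suc m)
    have c: "(\<lambda>\<omega>. \<omega> m) \<in> PiM {0..<i} (\<lambda>_. count_space UNIV :: ('s\<times>'a) measure) \<rightarrow>\<^sub>M count_space UNIV"
      using Suc by (intro measurable_component_singleton) auto
    have "(\<lambda>x. measure_pmf (bind_pmf (trans M (fst x) (snd x)) (\<lambda>s'. map_pmf (Pair s') (\<pi> s')))) \<in> count_space UNIV \<rightarrow>\<^sub>M subprob_algebra (count_space UNIV)"
      by (auto simp: space_subprob_algebra intro!: measure_pmf.subprob_space_axioms)
    from measurable_compose[OF c this] Suc show ?thesis by (simp add: traj_kernel_def)
  qed
qed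

primrec traj_marginal ::
  "('s::finite, 'a::finite) mdp \<Rightarrow> ('s, 'a) policy \<Rightarrow> ('s \<times> 'a) pmf \<Rightarrow> nat \<Rightarrow> ('s \<times> 'a) pmf" where
  "traj_marginal (M :: ('s::finite,'a::finite) mdp) \<pi> \<mu> 0 = \<mu>"
| "traj_marginal M \<pi> \<mu> (Suc n) = bind_pmf (traj_marginal M \<pi> \<mu> n) (\<lambda>x. bind_pmf (trans M (fst x) (snd x)) (\<lambda>s'. map_pmf (Pair s') (\<pi> s')))"

lemma
  fixes M :: "('s::finite,'a::finite) mdp" and \<pi> \<mu>
  defines "P \<equiv> (\<lambda>n \<omega>. measure_pmf (traj_kernel M \<pi> \<mu> n \<omega>))" 
  shows C_traj_marginal: "distr (Ionescu_Tulcea.C P (\<lambda>_. count_space UNIV) 0 (Suc n) (\<lambda>_. undefined)) (count_space UNIV) (\<lambda>\<omega>. \<omega> n) = measure_pmf (traj_marginal M \<pi> \<mu> n)"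
    and distr_traj_law: "distr (traj_law M \<pi> \<mu>) (count_space UNIV) (\<lambda>\<omega>. \<omega> n) = measure_pmf (traj_marginal M \<pi> \<mu> n)"
    and prob_space_traj_law: "prob_space (traj_law M \<pi> \<mu>)"
    and sets_traj_law: "sets (traj_law M \<pi> \<mu>) = sets (PiM UNIV (\<lambda>_. count_space UNIV))"
proof -
  interpret I: Ionescu_Tulcea P "\<lambda>_. count_space UNIV" unfolding P_def by (rule Ionescu_Tulcea_traj_kernel)
  let ?u = "\<lambda>_::nat. undefined :: 's \<times> 'a"
  let ?CS = "\<lambda>_::nat. count_space UNIV :: ('s \<times> 'a) measure"
  have u: "?u \<in> space (PiM {0..<0} ?CS)" by (auto simp: space_PiM)
  have cm: "(\<lambda>\<omega>. \<omega> n) \<in> PiM {0..<Suc n} ?CS \<rightarrow>\<^sub>M count_space UNIV" for n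
    by (intro measurable_component_singleton) auto
  have step: "distr (I.C 0 (Suc n) ?u) (count_space UNIV) (\<lambda>\<omega>. \<omega> n) = I.C 0 n ?u \<bind> P n" for n
  proof -
    have ne: "space (I.C 0 n ?u) \<noteq> {}"
      using I.prob_space_C[OF u, of n] by (rule prob_space.not_empty)
    have "distr (I.C 0 n ?u \<bind> I.eP n) (count_space UNIV) (\<lambda>\<omega>. \<omega> n) =
       I.C 0 n ?u \<bind> (\<lambda>\<omega>. distr (I.eP n \<omega>) (count_space UNIV) (\<lambda>\<omega>. \<omega> n))"
    proof (rule distr_bind[OF _ ne cm])
      show "I.eP n \<in> I.C 0 n ?u \<rightarrow>\<^sub>M subprob_algebra (PiM {0..<Suc n} ?CS)"
        using I.measurable_eP[of n] I.sets_C[OF u, of n] by (simp cong: measurable_cong_sets)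
    qed
    also have "\<dots> = I.C 0 n ?u \<bind> P n"
    proof (rule bind_cong[OF refl])
      fix \<omega> assume "\<omega> \<in> space (I.C 0 n ?u)" 
      then have w: "\<omega> \<in> space (PiM {0..<n} ?CS)" using I.space_C[OF u, of n] by simp
      show "distr (I.eP n \<omega>) (count_space UNIV) (\<lambda>\<omega>. \<omega> n) = P n \<omega>"
        unfolding I.eP_def
        apply (subst distr_distr[OF cm])
         apply (simp add: P_def)
        subgoal using w by (auto simp: space_PiM PiE_iff extensional_def)
        apply (simp add: comp_def P_def)
        apply (rule distr_id2, simp)
        done
    qed
    finally show ?thesis by simp
  qed
  show C: "distr (I.C 0 (Suc n) ?u) (count_space UNIV) (\<lambda>\<omega>. \<omega> n) = measure_pmf (traj_marginal M \<pi> \<mu> n)" for n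
  proof (induction n)
    case 0
    show ?case unfolding step
      apply simp
      apply (subst bind_return[where N="count_space UNIV"])
      using I.P[of 0] u apply (auto simp: P_def traj_kernel_def)
      done
  next
    case (Suc n)
    let ?K = "\<lambda>x. bind_pmf (trans M (fst x) (snd x)) (\<lambda>s'. map_pmf (Pair s') (\<pi> s'))"
    have ne: "space (I.C 0 (Suc n) ?u) \<noteq> {}"
      using I.prob_space_C[OF u, of "Suc n"] by (rule prob_space.not_empty)
    have "I.C 0 (Suc n) ?u \<bind> P (Suc n) = I.C 0 (Suc n) ?u \<bind> (\<lambda>\<omega>. measure_pmf (?K (\<omega> n)))"
      by (simp add: P_def traj_kernel_def)
    also have "\<dots> = distr (I.C 0 (Suc n) ?u) (count_space UNIV) (\<lambda>\<omega>. \<omega> n) \<bind> (\<lambda>x. measure_pmf (?K x))"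
      apply (rule bind_distr[symmetric, where K="count_space UNIV"])
      using I.sets_C[OF u, of "Suc n"] cm[of n]  apply (simp cong: measurable_cong_sets)
      apply (auto simp: space_subprob_algebra intro!: measure_pmf.subprob_space_axioms)[1]
      using ne apply simp
      done
    also have "\<dots> = measure_pmf (traj_marginal M \<pi> \<mu> (Suc n))"
      unfolding Suc.IH by (simp add: measure_pmf_bind)
    finally show ?case unfolding step[of "Suc n"] .
  qed
  have law: "traj_law M \<pi> \<mu> = I.PF.lim" by (simp add: traj_law_def P_def)
  show sl: "sets (traj_law M \<pi> \<mu>) = sets (PiM UNIV ?CS)" unfolding law by simp
  have emb: "emeasure I.PF.lim (I.PF.emb UNIV {0..<Suc n} X) = emeasure (I.C 0 (Suc n) ?u) X" if "X \<in> sets (PiM {0..<Suc n} ?CS)" for X n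
    using I.lim[of "{0..<Suc n}" X] that I.emeasure_CI[of "{0..<Suc n}" "Suc n" X] 
    sets.sets_into_space[OF that] by (simp add: prod_emb_id space_PiM)
  show "prob_space (traj_law M \<pi> \<mu>)"
  proof
    have "emeasure I.PF.lim (I.PF.emb UNIV {0..<Suc 0} (space (PiM {0..<Suc 0} ?CS))) = 1"
      using emb[of "space (PiM {0..<Suc 0} ?CS)" 0] I.prob_space_C[OF u, of "Suc 0", THEN prob_space.emeasure_space_1] I.space_C[OF u, of "Suc 0"] by simp
    moreover have "I.PF.emb UNIV {0..<Suc 0} (space (PiM {0..<Suc 0} ?CS)) = space (traj_law M \<pi> \<mu>)"
      unfolding sets_eq_imp_space_eq[OF sl] by (auto simp: prod_emb_def space_PiM)
    ultimately show "emeasure (traj_law M \<pi> \<mu>) (space (traj_law M \<pi> \<mu>)) = 1" by (simp add: law)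
  qed
  show "distr (traj_law M \<pi> \<mu>) (count_space UNIV) (\<lambda>\<omega>. \<omega> n) = measure_pmf (traj_marginal M \<pi> \<mu> n)"
    unfolding C[symmetric]
  proof (rule measure_eqI)
    fix A assume "A \<in> sets (distr (traj_law M \<pi> \<mu>) (count_space UNIV) (\<lambda>\<omega>. \<omega> n))"
    let ?X = "(\<lambda>\<omega>. \<omega> n) -` A \<inter> space (PiM {0..<Suc n} ?CS)"
    have X: "?X \<in> sets (PiM {0..<Suc n} ?CS)" using cm by (rule measurable_sets) simp
    have "emeasure (distr (traj_law M \<pi> \<mu>) (count_space UNIV) (\<lambda>\<omega>. \<omega> n)) A = emeasure I.PF.lim ((\<lambda>\<omega>. \<omega> n) -` A \<inter> space I.PF.lim)"
      unfolding law
      using measurable_component_singleton[of n UNIV ?CS] 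
      by (intro emeasure_distr) (simp_all add: measurable_cong_sets[OF sl[unfolded law] refl])
    also have "(\<lambda>\<omega>. \<omega> n) -` A \<inter> space I.PF.lim = I.PF.emb UNIV {0..<Suc n} ?X"
      unfolding sets_eq_imp_space_eq[OF sl, unfolded law] by (auto simp: prod_emb_def space_PiM)
    also have "emeasure I.PF.lim \<dots> = emeasure (I.C 0 (Suc n) ?u) ?X" by (rule emb[OF X])
    also have "\<dots> = emeasure (distr (I.C 0 (Suc n) ?u) (count_space UNIV) (\<lambda>\<omega>. \<omega> n)) A"
      using I.sets_C[OF u, of "Suc n"] I.space_C[OF u, of "Suc n"] cm[of n]
      by (subst emeasure_distr) (simp_all cong: measurable_cong_sets)
    finally show "emeasure (distr (traj_law M \<pi> \<mu>) (count_space UNIV) (\<lambda>\<omega>. \<omega> n)) A = emeasure (distr (I.C 0 (Suc n) ?u) (count_space UNIV) (\<lambda>\<omega>. \<omega> n)) A" .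
  qed simp
qed

lemma integral_discounted_return: fixes M :: "('s::finite,'a::finite) mdp" assumes "valid_mdp M"
  shows "(\<integral>\<omega>. discounted_return M \<omega> \<partial>traj_law M \<pi> \<mu>) = (\<Sum>t. discount M ^ t * measure_pmf.expectation (traj_marginal M \<pi> \<mu> t) (\<lambda>x. reward M (fst x) (snd x)))"
proof -
  interpret p: prob_space "traj_law M \<pi> \<mu>" by (rule prob_space_traj_law)
  have m[measurable]: "(\<lambda>\<omega>. \<omega> n) \<in> traj_law M \<pi> \<mu> \<rightarrow>\<^sub>M count_space UNIV" for n
    using measurable_component_singleton[of n UNIV "\<lambda>_. count_space UNIV :: ('s\<times>'a) measure"] sets_traj_law[of M \<pi> \<mu>] 
    by (simp cong: measurable_cong_sets)
  have bd: "0 \<le> reward M s a" "reward M s a \<le> 1" "0 \<le> discount M" "discount M < 1" for s a using assms by (auto simp: valid_mdp_def)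
  have meas: "(\<lambda>\<omega>. reward M (fst (\<omega> t)) (snd (\<omega> t))) \<in> borel_measurable (traj_law M \<pi> \<mu>)" for t
    by (rule measurable_compose[OF m]) simp
  have int: "integrable (traj_law M \<pi> \<mu>) (\<lambda>\<omega>. reward M (fst (\<omega> t)) (snd (\<omega> t)))" for t
    by (rule p.integrable_const_bound[where B=1]) (use bd meas in auto)
  have E: "(\<integral>\<omega>. reward M (fst (\<omega> t)) (snd (\<omega> t)) \<partial>traj_law M \<pi> \<mu>) = measure_pmf.expectation (traj_marginal M \<pi> \<mu> t) (\<lambda>x. reward M (fst x) (snd x))" for t
    unfolding distr_traj_law[symmetric] by (subst integral_distr[OF m]) auto
  have s1: "summable (\<lambda>t. norm (discount M ^ t * reward M (fst (\<omega> t)) (snd (\<omega> t))))" for \<omega>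
    by (rule summable_comparison_test'[OF summable_geometric[of "discount M"], of 0]) (use bd in \<open>auto simp: abs_mult mult_left_le\<close>)
  have "(\<lambda>t. \<integral>\<omega>. discount M ^ t * reward M (fst (\<omega> t)) (snd (\<omega> t)) \<partial>traj_law M \<pi> \<mu>) sums (\<integral>\<omega>. discounted_return M \<omega> \<partial>traj_law M \<pi> \<mu>)"
    unfolding discounted_return_def
  proof (rule sums_integral)
    show "summable (\<lambda>t. \<integral>\<omega>. norm (discount M ^ t * reward M (fst (\<omega> t)) (snd (\<omega> t))) \<partial>traj_law M \<pi> \<mu>)"
    proof (rule summable_comparison_test'[OF summable_geometric[of "discount M"], of 0])
      show "norm (\<integral>\<omega>. norm (discount M ^ n * reward M (fst (\<omega> n)) (snd (\<omega> n))) \<partial>traj_law M \<pi> \<mu>) \<le> discount M ^ n" for n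
        using p.integral_le_const[of "\<lambda>\<omega>. norm (discount M ^ n * reward M (fst (\<omega> n)) (snd (\<omega> n)))" "discount M ^ n"] int[of n] bd
        by (auto simp: abs_mult mult_left_le)
    qed (use bd in auto)
  qed (use int s1 in auto)
  then show ?thesis using E by (simp add: sums_iff)
qed

definition V :: "('s, 'a) mdp \<Rightarrow> ('s, 'a) policy \<Rightarrow> 's \<Rightarrow> real" where
  "V M \<pi> s = (\<integral>\<omega>. discounted_return M \<omega> \<partial>traj_law M \<pi> (map_pmf (Pair s) (\<pi> s)))"

definition Q :: "('s, 'a) mdp \<Rightarrow> ('s, 'a) policy \<Rightarrow> 's \<Rightarrow> 'a \<Rightarrow> real" where
  "Q M \<pi> s a = (\<integral>\<omega>. discounted_return M \<omega> \<partial>traj_law M \<pi> (return_pmf (s, a)))"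

text \<open>The maxima over the infinite set of all policies are written as suprema.\<close>

definition Vstar :: "('s, 'a) mdp \<Rightarrow> 's \<Rightarrow> real" where
  "Vstar M s = (SUP \<pi>. V M \<pi> s)"

definition Qstar :: "('s, 'a) mdp \<Rightarrow> 's \<Rightarrow> 'a \<Rightarrow> real" where
  "Qstar M s a = (SUP \<pi>. Q M \<pi> s a)"

definition opt_actions :: "('s, 'a) mdp \<Rightarrow> 's \<Rightarrow> 'a set" where
  "opt_actions M s = {a. Qstar M s a = Vstar M s}"

definition S_eq1 :: "('s, 'a) mdp \<Rightarrow> 's set" where
  "S_eq1 M = {s. card (opt_actions M s) = 1}"

definition S_gt1 :: "('s, 'a) mdp \<Rightarrow> 's set" where
  "S_gt1 M = {s. card (opt_actions M s) > 1}"

definition S_tilde :: "('s, 'a) mdp \<Rightarrow> 's set" where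
  "S_tilde M = {s. opt_actions M s \<noteq> UNIV}"

definition gap_at :: "('s::finite, 'a::finite) mdp \<Rightarrow> 's \<Rightarrow> real" where
  "gap_at M s = Vstar M s - (MAX a'\<in>- opt_actions M s. Qstar M s a')"

definition gap :: "('s::finite, 'a::finite) mdp \<Rightarrow> real" where
  "gap M = (MIN s\<in>S_tilde M. gap_at M s)"

definition subopt_mass :: "('s, 'a::finite) mdp \<Rightarrow> ('s, 'a) policy \<Rightarrow> 's \<Rightarrow> real" where
  "subopt_mass M \<pi> s = (\<Sum>a'\<in>- opt_actions M s. pmf (\<pi> s) a')"

definition sup_norm :: "('x::finite \<Rightarrow> real) \<Rightarrow> real" where
  "sup_norm f = (MAX x. \<bar>f x\<bar>)"


section \<open>Mirror maps\<close>

definition edom :: "(real \<Rightarrow> ereal) \<Rightarrow> real set" where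
  "edom \<psi> = {x. \<psi> x < \<infinity>}"

definition eepigraph :: "(real \<Rightarrow> ereal) \<Rightarrow> (real \<times> real) set" where
  "eepigraph \<psi> = {(x, t). \<psi> x \<le> ereal t}"

text \<open>Derivatives of \<open>\<psi>\<close>, meaningful on the interior of its domain, where \<open>\<psi>\<close> is finite.\<close>

definition dpsi :: "(real \<Rightarrow> ereal) \<Rightarrow> real \<Rightarrow> real" where
  "dpsi \<psi> = deriv (\<lambda>x. real_of_ereal (\<psi> x))"

definition ddpsi :: "(real \<Rightarrow> ereal) \<Rightarrow> real \<Rightarrow> real" where
  "ddpsi \<psi> = deriv (dpsi \<psi>)"

definition mirror_map :: "(real \<Rightarrow> ereal) \<Rightarrow> bool" where
  "mirror_map \<psi> \<longleftrightarrow>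
     {0..1} \<subseteq> edom \<psi> \<and>
     (\<forall>x. \<psi> x \<noteq> -\<infinity>) \<and> edom \<psi> \<noteq> {} \<and> closed (eepigraph \<psi>) \<and> convex (eepigraph \<psi>) \<and>
     (\<forall>x\<in>interior (edom \<psi>). (\<lambda>y. real_of_ereal (\<psi> y)) differentiable (at x)) \<and>
     (\<forall>X l. (\<forall>n::nat. X n \<in> interior (edom \<psi>)) \<and> l \<in> frontier (edom \<psi>) \<and> X \<longlonglongrightarrow> l \<longrightarrow>
        filterlim (\<lambda>n. \<bar>dpsi \<psi> (X n)\<bar>) at_top sequentially) \<and>
     (\<forall>x\<in>interior (edom \<psi>). \<forall>y\<in>interior (edom \<psi>). \<forall>u\<in>{0<..<1}. x \<noteq> y \<longrightarrow>
        \<psi> ((1 - u) * x + u * y) < ereal (1 - u) * \<psi> x + ereal u * \<psi> y)"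

text \<open>The one-sided limits \<open>\<psi>'(0\<^sup>+)\<close> and \<open>\<psi>'(1\<^sup>-)\<close>; they exist in the extended reals because
  \<open>\<psi>'\<close> is monotone.\<close>

definition dpsi_0plus :: "(real \<Rightarrow> ereal) \<Rightarrow> ereal" where
  "dpsi_0plus \<psi> = Lim (at_right 0) (\<lambda>x. ereal (dpsi \<psi> x))"

definition dpsi_1minus :: "(real \<Rightarrow> ereal) \<Rightarrow> ereal" where
  "dpsi_1minus \<psi> = Lim (at_left 1) (\<lambda>x. ereal (dpsi \<psi> x))"

definition phi_inv :: "(real \<Rightarrow> ereal) \<Rightarrow> real \<Rightarrow> real" where
  "phi_inv \<psi> = the_inv_into {0<..1} (\<lambda>x. - dpsi \<psi> x)"

definition hmap :: "(real \<Rightarrow> ereal) \<Rightarrow> 'a::finite pmf \<Rightarrow> ereal" where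
  "hmap \<psi> p = (\<Sum>a\<in>UNIV. \<psi> (pmf p a))"

text \<open>The \<open>a\<close>-th component of \<open>\<nabla>h(q)\<close> is \<open>\<psi>'(q(a))\<close>.\<close>

definition bregman :: "(real \<Rightarrow> ereal) \<Rightarrow> 'a::finite pmf \<Rightarrow> 'a pmf \<Rightarrow> ereal" where
  "bregman \<psi> p q = hmap \<psi> p - hmap \<psi> q - ereal (\<Sum>a\<in>UNIV. dpsi \<psi> (pmf q a) * (pmf p a - pmf q a))"


section \<open>Policy mirror descent\<close>

definition pmd ::
  "('s::finite, 'a::finite) mdp \<Rightarrow> (real \<Rightarrow> ereal) \<Rightarrow> real \<Rightarrow> (nat \<Rightarrow> ('s, 'a) policy) \<Rightarrow> bool" where
  "pmd M \<psi> \<eta> \<pi> \<longleftrightarrow>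
     (\<forall>s a. pmf (\<pi> 0 s) a \<in> interior (edom \<psi>)) \<and>
     (\<forall>k s. is_arg_max
        (\<lambda>p. ereal (\<eta> * (\<Sum>a\<in>UNIV. pmf p a * Q M (\<pi> k) s a)) - bregman \<psi> p (\<pi> k s))
        (\<lambda>_. True) (\<pi> (Suc k) s))"

definition V_err :: "('s::finite, 'a) mdp \<Rightarrow> ('s, 'a) policy \<Rightarrow> real" where
  "V_err M \<pi> = sup_norm (\<lambda>s. Vstar M s - V M \<pi> s)"

definition T_iter :: "('s::finite, 'a) mdp \<Rightarrow> (nat \<Rightarrow> ('s, 'a) policy) \<Rightarrow> real \<Rightarrow> nat" where
  "T_iter M \<pi> \<sigma> = (LEAST k. V_err M (\<pi> k) \<le> \<sigma>)"

definition G ::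
  "('s, 'a::finite) mdp \<Rightarrow> (real \<Rightarrow> ereal) \<Rightarrow> (nat \<Rightarrow> ('s, 'a) policy) \<Rightarrow> nat \<Rightarrow> 's \<Rightarrow> real" where
  "G M \<psi> \<pi> k s =
     (MIN a\<in>opt_actions M s. dpsi \<psi> (pmf (\<pi> k s) a)) -
     (MAX a'\<in>- opt_actions M s. dpsi \<psi> (pmf (\<pi> k s) a'))"

definition C_at ::
  "('s::finite, 'a::finite) mdp \<Rightarrow> (real \<Rightarrow> ereal) \<Rightarrow> real \<Rightarrow> (nat \<Rightarrow> ('s, 'a) policy) \<Rightarrow> real \<Rightarrow> 's \<Rightarrow> real" where
  "C_at M \<psi> \<eta> \<pi> \<sigma> s =
     real_of_ereal (dpsi_1minus \<psi>) - G M \<psi> \<pi> (T_iter M \<pi> \<sigma>) s +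
     \<eta> * (gap M - 2 * \<sigma>) * real (T_iter M \<pi> \<sigma>)"

definition C1 ::
  "('s::finite, 'a::finite) mdp \<Rightarrow> (real \<Rightarrow> ereal) \<Rightarrow> real \<Rightarrow> (nat \<Rightarrow> ('s, 'a) policy) \<Rightarrow> real \<Rightarrow> real" where
  "C1 M \<psi> \<eta> \<pi> \<sigma> = (MAX s\<in>S_tilde M. C_at M \<psi> \<eta> \<pi> \<sigma> s)"

definition admissible_T1 ::
  "('s::finite, 'a::finite) mdp \<Rightarrow> (real \<Rightarrow> ereal) \<Rightarrow> real \<Rightarrow> (nat \<Rightarrow> ('s, 'a) policy) \<Rightarrow> real \<Rightarrow> nat \<Rightarrow> bool" where
  "admissible_T1 M \<psi> \<eta> \<pi> \<sigma> T1 \<longleftrightarrow>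
     T_iter M \<pi> \<sigma> \<le> T1 \<and>
     (\<forall>k\<ge>T1. \<forall>s\<in>S_tilde M.
        real k * \<eta> * (gap M - 2 * \<sigma>) - C_at M \<psi> \<eta> \<pi> \<sigma> s \<ge> - real_of_ereal (dpsi_1minus \<psi>))"

end

theory Submission
  imports Defs
begin

text \<open>The first-order condition of a mirror descent step says that, for any two actions \<open>a\<close> and \<open>b\<close>, the
  gap \<open>\<psi>'(\<pi>\<^sub>k(a|s)) - \<psi>'(\<pi>\<^sub>k(b|s))\<close> grows by exactly \<open>\<eta> (Q\<^sub>k(s,a) - Q\<^sub>k(s,b))\<close> in each iteration
  (\<open>stationary\<close>). Everything follows from this identity, from the steepness of \<open>\<psi>\<close> at \<open>0\<close> and from its
  smoothness at \<open>1\<close>.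

  Values: by monotonicity of \<open>\<psi>'\<close> the identity makes the values increase, so they have a limit.
  An action that is strictly dominated under the limiting values is beaten by a gap that grows at least linearly, and as
  \<open>\<psi>'\<close> is bounded above by \<open>\<psi>'(1)\<close> its own \<open>\<psi>'\<close> falls to \<open>-\<infinity>\<close> at least linearly; so its probability vanishes
  (\<open>summable_dominated_action\<close>). Hence the limit solves the Bellman optimality equation and is the
  optimal value function (\<open>Vlim_eq_Max\<close>, \<open>Vstar_eq_Vlim\<close>).

  Summability: because \<open>\<psi>(0)\<close> is finite, a sequence along which \<open>\<psi>'\<close> falls linearly is even summable
  (\<open>summable_of_dpsi_linear_decay\<close>, by telescoping the convex conjugate of \<open>\<psi>\<close>). Thus the suboptimal
  mass is summable over the iterations, and so is the value error, which it dominates up to a constant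
  (\<open>V_err_le_subopt_mass\<close>).

  Policies: between two optimal actions the gap moves by at most \<open>\<eta>\<close> times the value error per
  iteration, hence by a summable amount. Between two iterates all optimal actions therefore shift by
  nearly the same amount of \<open>\<psi>'\<close>, while their total probability changes only by the change of the
  suboptimal mass. If all optimal probabilities move in the same direction, each moves by at most the
  total change; if two move in opposite directions, both shifts of \<open>\<psi>'\<close> are small and a lower bound on
  \<open>\<psi>''\<close> makes the moves small (\<open>balanced_displacement_le\<close>). This gives the Cauchy property, hence the
  limit, and, letting the later iterate tend to infinity, the rate in part (b).

  Part (a) is the explicit form of the linear fall of \<open>\<psi>'\<close> at suboptimal actions, inverted by
  \<open>\<phi>\<^sup>-\<^sup>1\<close> (\<open>subopt_mass_le_phi_inv\<close>); with a single optimal action the limit is deterministic, and the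
  suboptimal mass controls the distance to it.\<close>

section \<open>Bellman equations and comparison of value functions\<close>

definition return_from :: "('s::finite, 'a::finite) mdp \<Rightarrow> ('s, 'a) policy \<Rightarrow> ('s \<times> 'a) pmf \<Rightarrow> real" where
  "return_from M \<pi> \<mu> = (\<Sum>t. discount M ^ t *
     measure_pmf.expectation (traj_marginal M \<pi> \<mu> t) (\<lambda>x. reward M (fst x) (snd x)))"

definition backup :: "('s::finite, 'a::finite) mdp \<Rightarrow> ('s \<Rightarrow> real) \<Rightarrow> 's \<Rightarrow> 'a \<Rightarrow> real" where
  "backup M v s a = reward M s a + discount M * (\<Sum>s'\<in>UNIV. pmf (trans M s a) s' * v s')"

lemma traj_marginal_bind:
  "traj_marginal M \<pi> (bind_pmf \<mu> f) n = bind_pmf \<mu> (\<lambda>x. traj_marginal M \<pi> (f x) n)"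
  by (induction n) (simp_all add: bind_assoc_pmf)

text \<open>Forgetting the first pair leaves a trajectory that starts from the law of the second pair; this is the
  Markov property behind the Bellman equation.\<close>

lemma traj_marginal_shift:
  "traj_marginal M \<pi> \<mu> (Suc n) = traj_marginal M \<pi>
     (bind_pmf \<mu> (\<lambda>x. bind_pmf (trans M (fst x) (snd x)) (\<lambda>s'. map_pmf (Pair s') (\<pi> s')))) n"
  by (induction n) simp_all

lemma sum_pmf_UNIV: "(\<Sum>x\<in>UNIV. pmf (p :: 'c::finite pmf) x) = 1"
  by (simp add: sum_pmf_eq_1)

lemma pmf_average_le:
  fixes p :: "'c::finite pmf"
  assumes "\<And>x. w x \<le> c"
  shows "(\<Sum>x\<in>UNIV. pmf p x * w x) \<le> c"
proof -
  have "(\<Sum>x\<in>UNIV. pmf p x * w x) \<le> (\<Sum>x\<in>UNIV. pmf p x * c)"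
    by (intro sum_mono mult_left_mono assms) simp
  then show ?thesis by (simp add: sum_distrib_right[symmetric] sum_pmf_UNIV)
qed

lemma backup_diff:
  "backup M v s a - backup M w s a = discount M * (\<Sum>s'\<in>UNIV. pmf (trans M s a) s' * (v s' - w s'))"
  by (simp add: backup_def right_diff_distrib sum_subtractf)

context
  fixes M :: "('s::finite, 'a::finite) mdp"
  assumes valid: "valid_mdp M"
begin

lemma reward_bounds: "0 \<le> reward M s a" "reward M s a \<le> 1"
  and discount_bounds: "0 \<le> discount M" "discount M < 1"
  using valid by (auto simp: valid_mdp_def)

lemma expected_reward_le_1:
  "\<bar>measure_pmf.expectation \<mu> (\<lambda>x. reward M (fst x) (snd x))\<bar> \<le> 1"
proof -
  have "0 \<le> measure_pmf.expectation \<mu> (\<lambda>x. reward M (fst x) (snd x))"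
    by (intro integral_nonneg_AE) (simp add: reward_bounds)
  moreover have "measure_pmf.expectation \<mu> (\<lambda>x. reward M (fst x) (snd x)) \<le> 1"
    by (intro measure_pmf.integral_le_const integrable_measure_pmf_finite)
       (simp_all add: reward_bounds)
  ultimately show ?thesis by simp
qed

lemma summable_return:
  "summable (\<lambda>t. discount M ^ t *
     measure_pmf.expectation (traj_marginal M \<pi> \<mu> t) (\<lambda>x. reward M (fst x) (snd x)))"
  by (rule summable_comparison_test'[OF summable_geometric[of "discount M"], of 0])
     (use discount_bounds expected_reward_le_1 in \<open>auto simp: abs_mult mult_left_le\<close>)

lemma return_from_bind:
  fixes \<mu> :: "'c::finite pmf"
  shows "return_from M \<pi> (bind_pmf \<mu> f) = (\<Sum>x\<in>UNIV. pmf \<mu> x * return_from M \<pi> (f x))"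
proof -
  have "return_from M \<pi> (bind_pmf \<mu> f) = (\<Sum>t. \<Sum>x\<in>UNIV. pmf \<mu> x * (discount M ^ t *
     measure_pmf.expectation (traj_marginal M \<pi> (f x) t) (\<lambda>x. reward M (fst x) (snd x))))"
    unfolding return_from_def traj_marginal_bind
    by (subst pmf_expectation_bind[of UNIV]) (simp_all add: sum_distrib_left mult_ac)
  also have "\<dots> = (\<Sum>x\<in>UNIV. pmf \<mu> x * return_from M \<pi> (f x))"
    unfolding return_from_def
    by (subst suminf_sum) (simp_all add: summable_return suminf_mult summable_mult)
  finally show ?thesis .
qed

lemma return_from_step:
  "return_from M \<pi> \<mu> = measure_pmf.expectation \<mu> (\<lambda>x. reward M (fst x) (snd x)) +
     discount M * return_from M \<pi>
     (bind_pmf \<mu> (\<lambda>x. bind_pmf (trans M (fst x) (snd x)) (\<lambda>s'. map_pmf (Pair s') (\<pi> s'))))"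
proof -
  let ?e = "\<lambda>\<mu> t. measure_pmf.expectation (traj_marginal M \<pi> \<mu> t) (\<lambda>x. reward M (fst x) (snd x))"
  let ?\<mu>' = "bind_pmf \<mu> (\<lambda>x. bind_pmf (trans M (fst x) (snd x)) (\<lambda>s'. map_pmf (Pair s') (\<pi> s')))"
  have "(\<Sum>t. discount M ^ t * ?e \<mu> t) = (\<Sum>t. discount M ^ Suc t * ?e \<mu> (Suc t)) + ?e \<mu> 0"
    using suminf_split_head[OF summable_return[of \<pi> \<mu>]] by simp
  also have "(\<Sum>t. discount M ^ Suc t * ?e \<mu> (Suc t)) = (\<Sum>t. discount M * (discount M ^ t * ?e ?\<mu>' t))"
    by (simp only: traj_marginal_shift power_Suc mult.assoc)
  also have "\<dots> = discount M * (\<Sum>t. discount M ^ t * ?e ?\<mu>' t)"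
    by (rule suminf_mult[OF summable_return])
  finally show ?thesis by (simp add: return_from_def)
qed

lemma V_return_from: "V M \<pi> s = return_from M \<pi> (map_pmf (Pair s) (\<pi> s))"
  and Q_return_from: "Q M \<pi> s a = return_from M \<pi> (return_pmf (s, a))"
  by (simp_all add: V_def Q_def return_from_def integral_discounted_return[OF valid])

lemma V_eq_sum_Q: "V M \<pi> s = (\<Sum>a\<in>UNIV. pmf (\<pi> s) a * Q M \<pi> s a)"
  by (simp add: V_return_from Q_return_from map_pmf_def return_from_bind)

lemma Q_eq_backup: "Q M \<pi> s a = backup M (V M \<pi>) s a"
  by (simp add: Q_return_from return_from_step[of _ "return_pmf (s, a)"] bind_return_pmf
      return_from_bind backup_def V_return_from)

lemma backup_diff_le:
  assumes "\<And>s'. v s' - w s' \<le> c"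
  shows "backup M v s a - backup M w s a \<le> discount M * c"
  unfolding backup_diff by (intro mult_left_mono pmf_average_le assms discount_bounds)

lemma backup_mono:
  assumes "\<And>s'. v s' \<le> w s'"
  shows "backup M v s a \<le> backup M w s a"
  using backup_diff_le[of v w 0 s a] assms by simp

text \<open>Apply the hypothesis at a maximiser of \<open>d\<close>, with \<open>c\<close> its maximum: the maximum is at most \<open>discount M < 1\<close>
  times itself. This is the form in which the contraction property of Bellman operators is used.\<close>

lemma contraction_nonpos:
  fixes d :: "'s \<Rightarrow> real"
  assumes "\<And>c s. (\<And>s'. d s' \<le> c) \<Longrightarrow> d s \<le> discount M * c"
  shows "d s \<le> 0"
proof -
  let ?m = "Max (range d)"
  have le: "d s' \<le> ?m" for s' by simp
  have "?m \<in> range d" by (intro Max_in) auto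
  then obtain s0 where "?m = d s0" by blast
  with assms[OF le, of s0] have "?m * (1 - discount M) \<le> 0" by (simp add: algebra_simps)
  then have "?m \<le> 0" using discount_bounds by (simp add: mult_le_0_iff)
  then show ?thesis using le[of s] by linarith
qed

text \<open>Comparison principle: the excess of the value over a supersolution of the Bellman equation satisfies a
  contracting inequality, so it cannot be positive.\<close>

lemma V_le_supersolution:
  assumes "\<And>s. (\<Sum>a\<in>UNIV. pmf (\<pi> s) a * backup M v s a) \<le> v s"
  shows "V M \<pi> s \<le> v s"
proof -
  have "V M \<pi> s - v s \<le> 0"
  proof (rule contraction_nonpos)
    fix c s assume c: "\<And>s'. V M \<pi> s' - v s' \<le> c"
    have "V M \<pi> s - v s \<le> (\<Sum>a\<in>UNIV. pmf (\<pi> s) a * (backup M (V M \<pi>) s a - backup M v s a))"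
      using assms[of s] by (simp add: V_eq_sum_Q[of _ s] Q_eq_backup right_diff_distrib sum_subtractf)
    also have "\<dots> \<le> discount M * c"
      by (intro pmf_average_le backup_diff_le c)
    finally show "V M \<pi> s - v s \<le> discount M * c" .
  qed
  then show ?thesis by simp
qed

lemma subsolution_le_V:
  assumes "\<And>s. v s \<le> (\<Sum>a\<in>UNIV. pmf (\<pi> s) a * backup M v s a)"
  shows "v s \<le> V M \<pi> s"
proof -
  have "v s - V M \<pi> s \<le> 0"
  proof (rule contraction_nonpos)
    fix c s assume c: "\<And>s'. v s' - V M \<pi> s' \<le> c"
    have "v s - V M \<pi> s \<le> (\<Sum>a\<in>UNIV. pmf (\<pi> s) a * (backup M v s a - backup M (V M \<pi>) s a))"
      using assms[of s] by (simp add: V_eq_sum_Q[of _ s] Q_eq_backup right_diff_distrib sum_subtractf)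
    also have "\<dots> \<le> discount M * c"
      by (intro pmf_average_le backup_diff_le c)
    finally show "v s - V M \<pi> s \<le> discount M * c" .
  qed
  then show ?thesis by simp
qed

lemma V_bounds: "0 \<le> V M \<pi> s" "V M \<pi> s \<le> 1 / (1 - discount M)"
proof -
  show "0 \<le> V M \<pi> s"
    by (rule subsolution_le_V) (auto intro!: sum_nonneg simp: backup_def reward_bounds)
  have "reward M s a + discount M / (1 - discount M) \<le> 1 / (1 - discount M)" for s a
  proof -
    have "1 + discount M / (1 - discount M) = 1 / (1 - discount M)"
      using discount_bounds by (simp add: field_simps)
    then show ?thesis using reward_bounds(2)[of s a] by linarith
  qed
  then show "V M \<pi> s \<le> 1 / (1 - discount M)"
    by (intro V_le_supersolution pmf_average_le)
       (simp add: backup_def sum_divide_distrib[symmetric] sum_pmf_UNIV)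
qed

end

section \<open>Mirror maps that are steep at zero and smooth at one\<close>

locale steep_mirror_map =
  fixes \<psi> :: "real \<Rightarrow> ereal"
  assumes mirror: "mirror_map \<psi>"
    and dpsi_0: "dpsi_0plus \<psi> = -\<infinity>"
    and dpsi_1: "dpsi_1minus \<psi> < \<infinity>"
    and dpsi_differentiable: "\<And>x. x \<in> interior (edom \<psi>) \<Longrightarrow> dpsi \<psi> differentiable (at x)"
    and ddpsi_continuous: "continuous_on (interior (edom \<psi>)) (ddpsi \<psi>)"
    and ddpsi_pos: "\<And>x. x \<in> interior (edom \<psi>) \<Longrightarrow> 0 < ddpsi \<psi> x"
begin

abbreviation "f x \<equiv> real_of_ereal (\<psi> x)"
abbreviation "g \<equiv> dpsi \<psi>"

lemma edom_01: "{0..1} \<subseteq> edom \<psi>"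
  using mirror by (simp add: mirror_map_def)

lemma psi_eq_f: "x \<in> edom \<psi> \<Longrightarrow> \<psi> x = ereal (f x)"
proof -
  assume "x \<in> edom \<psi>"
  then have "\<psi> x \<noteq> \<infinity>" by (simp add: edom_def)
  moreover have "\<psi> x \<noteq> -\<infinity>" using mirror unfolding mirror_map_def by blast
  ultimately show ?thesis by (cases "\<psi> x") auto
qed

lemma psi_convex_combination:
  assumes "x \<in> edom \<psi>" "y \<in> edom \<psi>" "0 \<le> u" "0 \<le> v" "u + v = 1"
  shows "\<psi> (u * x + v * y) \<le> ereal (u * f x + v * f y)"
proof -
  have "convex (eepigraph \<psi>)" using mirror by (simp add: mirror_map_def)
  moreover have "(x, f x) \<in> eepigraph \<psi>" "(y, f y) \<in> eepigraph \<psi>"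
    using assms(1,2) by (simp_all add: eepigraph_def psi_eq_f[symmetric])
  ultimately have "u *\<^sub>R (x, f x) + v *\<^sub>R (y, f y) \<in> eepigraph \<psi>"
    using assms(3-) by (rule convexD)
  then show ?thesis by (simp add: eepigraph_def)
qed

lemma convex_edom: "convex (edom \<psi>)"
proof (rule convexI)
  fix x y and u v :: real
  assume "x \<in> edom \<psi>" "y \<in> edom \<psi>" "0 \<le> u" "0 \<le> v" "u + v = 1"
  from psi_convex_combination[OF this] show "u *\<^sub>R x + v *\<^sub>R y \<in> edom \<psi>"
    by (auto simp: edom_def)
qed

lemma convex_f: "convex_on (edom \<psi>) f"
  unfolding convex_on_def
proof (intro conjI ballI allI impI convex_edom)
  fix x y and u v :: real
  assume xy: "x \<in> edom \<psi>" "y \<in> edom \<psi>" and uv: "0 \<le> u" "0 \<le> v" "u + v = 1"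
  have "u *\<^sub>R x + v *\<^sub>R y \<in> edom \<psi>" using convexD[OF convex_edom xy uv] .
  from psi_convex_combination[OF xy uv] psi_eq_f[OF this]
  show "f (u *\<^sub>R x + v *\<^sub>R y) \<le> u * f x + v * f y"
    by (metis ereal_less_eq(3) real_scaleR_def)
qed

lemma tangent_below:
  assumes "x \<in> interior (edom \<psi>)" "y \<in> edom \<psi>"
  shows "f x + g x * (y - x) \<le> f y"
proof -
  have "f differentiable (at x)" using mirror assms(1) by (simp add: mirror_map_def)
  then have "(f has_field_derivative g x) (at x)"
    unfolding dpsi_def DERIV_deriv_iff_real_differentiable by simp
  then have "(f has_field_derivative g x) (at x within edom \<psi>)"
    by (rule has_field_derivative_at_within)
  from convex_on_imp_above_tangent[OF convex_f convex_connected[OF convex_edom] assms this]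
  show ?thesis by simp
qed

lemma DERIV_g: "x \<in> interior (edom \<psi>) \<Longrightarrow> (g has_real_derivative ddpsi \<psi> x) (at x)"
  unfolding ddpsi_def
  by (rule DERIV_deriv_iff_real_differentiable[THEN iffD2, OF dpsi_differentiable])

lemma isCont_g: "x \<in> interior (edom \<psi>) \<Longrightarrow> isCont g x"
  using DERIV_g DERIV_isCont by blast

lemma Icc_in_interior:
  assumes "x \<in> interior (edom \<psi>)" "y \<in> interior (edom \<psi>)"
  shows "{x..y} \<subseteq> interior (edom \<psi>)"
proof (cases "x \<le> y")
  case True
  then show ?thesis
    using closed_segment_subset[OF assms convex_interior[OF convex_edom]]
    by (simp add: closed_segment_eq_real_ivl)
qed simp

lemma g_strict_mono:
  assumes "x \<in> interior (edom \<psi>)" "y \<in> interior (edom \<psi>)" "x < y"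
  shows "g x < g y"
proof (rule DERIV_pos_imp_increasing[OF assms(3)])
  fix z assume "x \<le> z" "z \<le> y"
  then have "z \<in> interior (edom \<psi>)" using Icc_in_interior[OF assms(1,2)] by auto
  then show "\<exists>d. DERIV g z :> d \<and> 0 < d" using DERIV_g ddpsi_pos by blast
qed

lemma open_unit_interior: "{0<..<1} \<subseteq> interior (edom \<psi>)"
  using edom_01 by (intro interior_maximal) auto

text \<open>At a boundary point \<open>\<bar>\<psi>'\<bar>\<close> blows up. At \<open>1\<close>, approached from the left, \<open>\<psi>'\<close> is increasing, so it could
  only tend to \<open>+\<infinity>\<close>, which the finiteness of its left limit excludes.\<close>

lemma one_in_interior: "1 \<in> interior (edom \<psi>)"
proof (rule ccontr)
  assume no: "1 \<notin> interior (edom \<psi>)"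
  define X where "X n = 1 - 1 / real (n + 2)" for n
  have X: "X n \<in> {0<..<1}" for n by (simp add: X_def field_simps)
  have "(1::real) \<in> frontier (edom \<psi>)"
    using no edom_01 closure_subset[of "edom \<psi>"] by (simp add: frontier_def subset_iff)
  moreover have "X \<longlonglongrightarrow> 1"
    unfolding X_def by real_asymp
  ultimately have lim: "filterlim (\<lambda>n. \<bar>g (X n)\<bar>) at_top sequentially"
    using mirror X open_unit_interior unfolding mirror_map_def by blast
  have Z: "\<exists>x\<in>{0<..<1}. Z \<le> g x" for Z
  proof -
    have "\<forall>\<^sub>F n in sequentially. max Z (1 - g (X 0)) \<le> \<bar>g (X n)\<bar>"
      using lim unfolding filterlim_at_top by blast
    then obtain n where n: "max Z (1 - g (X 0)) \<le> \<bar>g (X n)\<bar>"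
      by (auto simp: eventually_sequentially)
    have "X 0 \<le> X n" by (simp add: X_def field_simps)
    then have "g (X 0) \<le> g (X n)" 
      using g_strict_mono[of "X 0" "X n"] X[THEN subsetD[OF open_unit_interior]]
      by (cases "X 0 = X n") auto
    with n have "Z \<le> g (X n)" by linarith
    then show ?thesis using X by blast
  qed
  have "filterlim g at_top (at_left 1)"
    unfolding filterlim_at_top
  proof
    fix Z
    obtain x where x: "x \<in> {0<..<1}" "Z \<le> g x" using Z by blast
    show "\<forall>\<^sub>F y in at_left 1. Z \<le> g y"
    proof (rule eventually_at_leftI)
      fix y assume y: "y \<in> {x<..<1}"
      with x(1) have "x \<in> interior (edom \<psi>)" "y \<in> interior (edom \<psi>)"
        using open_unit_interior by (auto simp: subset_iff)
      from g_strict_mono[OF this] x y show "Z \<le> g y" by simp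
    qed (use x in auto)
  qed
  then have "((\<lambda>x. ereal (g x)) \<longlongrightarrow> \<infinity>) (at_left 1)"
    by (simp add: tendsto_PInfty_eq_at_top)
  then have "dpsi_1minus \<psi> = \<infinity>"
    unfolding dpsi_1minus_def by (intro tendsto_Lim) simp_all
  with dpsi_1 show False by simp
qed

lemma Ioc_interior: "x \<in> {0<..1} \<Longrightarrow> x \<in> interior (edom \<psi>)"
  using one_in_interior open_unit_interior by (cases "x = 1") auto

text \<open>The limit of \<open>\<psi>'\<close> at \<open>1\<close> is attained because \<open>1\<close> is an interior point, where \<open>\<psi>'\<close> is continuous.\<close>

lemma dpsi_1minus_eq: "dpsi_1minus \<psi> = ereal (g 1)"
proof -
  have "(g \<longlongrightarrow> g 1) (at_left 1)"
    using isCont_g[OF one_in_interior] by (simp add: isCont_def filterlim_at_split)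
  then show ?thesis unfolding dpsi_1minus_def by (intro tendsto_Lim) simp_all
qed

text \<open>At an interior point \<open>\<psi>'\<close> is continuous, hence has a finite limit.\<close>

lemma zero_notin_interior: "0 \<notin> interior (edom \<psi>)"
proof
  assume "0 \<in> interior (edom \<psi>)"
  then have "(g \<longlongrightarrow> g 0) (at_right 0)"
    using isCont_g by (simp add: isCont_def filterlim_at_split)
  then have "dpsi_0plus \<psi> = ereal (g 0)"
    unfolding dpsi_0plus_def by (intro tendsto_Lim) simp_all
  with dpsi_0 show False by simp
qed

lemma g_less: "\<lbrakk>0 < x; x < y; y \<le> 1\<rbrakk> \<Longrightarrow> g x < g y"
  by (intro g_strict_mono Ioc_interior) auto

lemma g_mono: "\<lbrakk>0 < x; x \<le> y; y \<le> 1\<rbrakk> \<Longrightarrow> g x \<le> g y"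
  using g_less[of x y] by (cases "x = y") auto

lemma g_le_cancel: "\<lbrakk>x \<in> {0<..1}; y \<in> {0<..1}; g x \<le> g y\<rbrakk> \<Longrightarrow> x \<le> y"
  using g_less[of y x] by force

text \<open>A monotone function bounded below has a finite limit at the left end of its domain, namely its infimum.\<close>

lemma g_unbounded_below: "\<exists>x\<in>{0<..1}. g x < Z"
proof (rule ccontr)
  assume "\<not> ?thesis"
  then have Z: "Z \<le> g x" if "x \<in> {0<..1}" for x using that by force
  define m where "m = (INF x\<in>{0<..1}. g x)"
  have bdd: "bdd_below (g ` {0<..1})" using Z by (intro bdd_belowI[of _ Z]) auto
  have "(g \<longlongrightarrow> m) (at_right 0)"
  proof (rule tendstoI)
    fix e :: real assume e: "0 < e"
    then obtain x where x: "x \<in> {0<..1}" "g x < m + e"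
      using cINF_less_iff[of "{0<..1}" g "m + e"] bdd unfolding m_def by force
    show "\<forall>\<^sub>F y in at_right 0. dist (g y) m < e"
    proof (rule eventually_at_rightI)
      fix y assume y: "y \<in> {0<..<x}"
      then have "g y < g x" using x by (intro g_less) auto
      moreover have "m \<le> g y" unfolding m_def using x y by (intro cINF_lower bdd) auto
      ultimately show "dist (g y) m < e" using x by (simp add: dist_real_def)
    qed (use x in auto)
  qed
  then have "dpsi_0plus \<psi> = ereal m"
    unfolding dpsi_0plus_def by (intro tendsto_Lim) simp_all
  with dpsi_0 show False by simp
qed

lemma g_attains:
  assumes "y \<le> g 1"
  shows "\<exists>x\<in>{0<..1}. g x = y"
proof -
  obtain z where z: "z \<in> {0<..1}" "g z < y" using g_unbounded_below by blast
  have "\<exists>x\<ge>z. x \<le> 1 \<and> g x = y"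
    using z assms by (intro IVT) (auto intro!: isCont_g Ioc_interior)
  with z show ?thesis by force
qed

lemma phi_inv_works:
  assumes "- g 1 \<le> y"
  shows "phi_inv \<psi> y \<in> {0<..1}" "g (phi_inv \<psi> y) = - y"
proof -
  have inj: "inj_on (\<lambda>x. - g x) {0<..1}"
  proof (rule inj_onI)
    fix x y assume "x \<in> {0<..1}" "y \<in> {0<..1}" "- g x = - g y"
    then show "x = y" using g_le_cancel[of x y] g_le_cancel[of y x] by simp
  qed
  obtain x where x: "x \<in> {0<..1}" "g x = - y" using g_attains[of "- y"] assms by auto
  then have "phi_inv \<psi> y = x"
    unfolding phi_inv_def using the_inv_into_f_f[OF inj x(1)] by simp
  with x show "phi_inv \<psi> y \<in> {0<..1}" "g (phi_inv \<psi> y) = - y" by simp_all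
qed

lemma le_phi_inv:
  assumes "x \<in> {0<..1}" "- g 1 \<le> y" "g x \<le> - y"
  shows "x \<le> phi_inv \<psi> y"
  by (rule g_le_cancel) (use phi_inv_works[OF assms(2)] assms in auto)

text \<open>It suffices to sum the points \<open>y k\<close> where the linear bound on \<open>\<psi>'\<close> is attained. The numbers
  \<open>F k = y k * \<psi>' (y k) - \<psi> (y k)\<close> are the values of the convex conjugate of \<open>\<psi>\<close> at the slopes
  \<open>\<psi>' (y k)\<close>. These slopes are equally spaced at distance \<open>c\<close>, and \<open>y (Suc k)\<close> is a subgradient of the
  conjugate, so \<open>F\<close> decreases by at least \<open>c * y (Suc k)\<close>. As the conjugate is bounded below by
  \<open>- \<psi> 0\<close>, the series converges.\<close>

lemma summable_of_dpsi_linear_decay: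
  fixes x :: "nat \<Rightarrow> real"
  assumes x: "\<And>k. x k \<in> {0<..1}" and c: "0 < c" and decay: "\<And>k. K \<le> k \<Longrightarrow> g (x k) \<le> C - c * real k"
  shows "summable x"
proof -
  \<comment> \<open>From \<open>N\<close> on, the prescribed slopes are at most \<open>\<psi>' 1\<close>, so they are attained in \<open>(0, 1]\<close>.\<close>
  obtain N where N: "real N \<ge> (C - g 1) / c" "N \<ge> K"
    using real_arch_simple[of "max ((C - g 1) / c) (real K)"] by (auto simp: max_def split: if_splits)
  define y where "y k = phi_inv \<psi> (c * real (k + N) - C)" for k
  have ge: "- g 1 \<le> c * real (k + N) - C" for k
  proof -
    have "C - g 1 \<le> c * real N" using N(1) c by (simp add: field_simps)
    also have "\<dots> \<le> c * real (k + N)" using c by simp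
    finally show ?thesis by simp
  qed
  have y: "y k \<in> {0<..1}" "g (y k) = C - c * real (k + N)" for k
    using phi_inv_works[OF ge[of k]] by (simp_all add: y_def)
  have xy: "x (k + N) \<le> y k" for k
    unfolding y_def by (rule le_phi_inv[OF x ge]) (use decay[of "k + N"] N(2) in simp)
  define F where "F k = y k * g (y k) - f (y k)" for k
  have e0: "0 \<in> edom \<psi>" using edom_01 by auto
  have ey: "y k \<in> edom \<psi>" for k using Ioc_interior[OF y(1)] interior_subset by blast
  have Fge: "- f 0 \<le> F k" for k
    using tangent_below[OF Ioc_interior[OF y(1)[of k]] e0] by (simp add: F_def algebra_simps)
  have Fstep: "c * y (Suc k) \<le> F k - F (Suc k)" for k
  proof -
    have "f (y k) + g (y k) * (y (Suc k) - y k) \<le> f (y (Suc k))"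
      by (rule tangent_below[OF Ioc_interior[OF y(1)] ey])
    then have "F k \<ge> y (Suc k) * g (y k) - f (y (Suc k))" by (simp add: F_def algebra_simps)
    then show ?thesis by (simp add: F_def y(2) algebra_simps)
  qed
  have "(\<Sum>k<n. c * y (Suc k)) \<le> F 0 - F n" for n
  proof (induction n)
    case (Suc n)
    then show ?case using Fstep[of n] by simp
  qed simp
  then have part: "(\<Sum>k<n. c * y (Suc k)) \<le> F 0 + f 0" for n
    by (rule order_trans) (use Fge[of n] in simp)
  have "summable (\<lambda>k. c * y (Suc k))"
    by (rule summableI_nonneg_bounded[OF _ part]) (use c y(1) in \<open>auto intro: less_imp_le\<close>)
  then have "summable y"
    using c summable_mult[of "\<lambda>k. c * y (Suc k)" "1 / c"] by (simp add: summable_Suc_iff)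
  then have "summable (\<lambda>k. x (k + N))"
    by (rule summable_comparison_test'[where N = 0]) (use x xy in \<open>simp add: less_imp_le\<close>)
  then show ?thesis by (simp add: summable_iff_shift)
qed

end

section \<open>First-order conditions of a mirror descent step\<close>

lemma ex_pmf_of_weights:
  fixes w :: "'c::finite \<Rightarrow> real"
  assumes "\<And>x. 0 \<le> w x" "(\<Sum>x\<in>UNIV. w x) = 1"
  shows "\<exists>p. \<forall>x. pmf p x = w x"
proof -
  have "(\<integral>\<^sup>+x. ennreal (w x) \<partial>count_space UNIV) = 1"
    using assms by (simp add: nn_integral_count_space_finite)
  then have "pmf (embed_pmf w) x = w x" for x
    by (intro pmf_embed_pmf assms)
  then show ?thesis by blast
qed

lemma pmf_add_le_1:
  fixes p :: "'c::finite pmf"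
  assumes "a \<noteq> b"
  shows "pmf p a + pmf p b \<le> 1"
  using sum_mono2[of UNIV "{a, b}" "pmf p"] assms by (simp add: sum_pmf_UNIV)

context steep_mirror_map
begin

lemma pmf_in_edom: "pmf p a \<in> edom \<psi>"
  using edom_01 by (auto simp: pmf_le_1)

text \<open>The objective of a mirror descent step from \<open>q\<close> has this form up to an additive constant, with
  \<open>c a = \<eta> * Q(s,a) + \<psi>' (q a)\<close>.\<close>

definition separable_objective :: "('a::finite \<Rightarrow> real) \<Rightarrow> 'a pmf \<Rightarrow> real" where
  "separable_objective c p = (\<Sum>a\<in>UNIV. pmf p a * c a - f (pmf p a))"

lemma mirror_step_objective:
  fixes p q :: "'a::finite pmf"
  shows "ereal (\<eta> * (\<Sum>a\<in>UNIV. pmf p a * w a)) - bregman \<psi> p q =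
    ereal (separable_objective (\<lambda>a. \<eta> * w a + g (pmf q a)) p +
      (\<Sum>a\<in>UNIV. f (pmf q a) - g (pmf q a) * pmf q a))"
proof -
  have h: "hmap \<psi> r = ereal (\<Sum>a\<in>UNIV. f (pmf r a))" for r :: "'a pmf"
    unfolding hmap_def sum_ereal[symmetric] by (intro sum.cong refl psi_eq_f pmf_in_edom)
  show ?thesis
    by (simp add: bregman_def h separable_objective_def sum_subtractf sum.distrib
        sum_distrib_left algebra_simps)
qed

text \<open>Moving mass \<open>t\<close> from \<open>b\<close> to \<open>a\<close> cannot increase the objective. Bounding the two changes of \<open>\<psi>\<close> by
  tangents at the perturbed points, which lie in \<open>(0, 1]\<close> even when \<open>pmf p a = 0\<close>, gives an inequality
  between derivatives that serves both for positivity and for stationarity of the maximizer.\<close>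

lemma maximizer_transfer:
  fixes p :: "'a::finite pmf"
  assumes max: "\<And>p'. separable_objective c p' \<le> separable_objective c p"
    and ab: "a \<noteq> b" and t: "0 < t" "t < pmf p b"
  shows "c a - g (pmf p a + t) \<le> c b - g (pmf p b - t)"
proof -
  define w where "w = (pmf p)(a := pmf p a + t, b := pmf p b - t)"
  have wab: "w a = pmf p a + t" "w b = pmf p b - t" using ab by (simp_all add: w_def)
  \<comment> \<open>Only the coordinates \<open>a\<close> and \<open>b\<close> contribute to a change of a separable sum.\<close>
  have on_ab: "(\<Sum>x\<in>UNIV. F x (w x) - F x (pmf p x)) =
      (F a (w a) - F a (pmf p a)) + (F b (w b) - F b (pmf p b))" for F :: "'a \<Rightarrow> real \<Rightarrow> real"
  proof -
    have "(\<Sum>x\<in>UNIV. F x (w x) - F x (pmf p x)) = (\<Sum>x\<in>{a, b}. F x (w x) - F x (pmf p x))"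
      by (rule sum.mono_neutral_right) (auto simp: w_def)
    then show ?thesis using ab by simp
  qed
  have "(\<Sum>x\<in>UNIV. w x) = 1"
    using on_ab[of "\<lambda>_ z. z"] by (simp add: wab sum_subtractf sum_pmf_UNIV)
  moreover have "0 \<le> w x" for x using t by (simp add: w_def)
  ultimately obtain p' where p': "\<And>x. pmf p' x = w x" using ex_pmf_of_weights[of w] by blast
  have "0 \<ge> separable_objective c p' - separable_objective c p" using max[of p'] by simp
  also have "separable_objective c p' - separable_objective c p =
      t * (c a - c b) - (f (pmf p a + t) - f (pmf p a)) - (f (pmf p b - t) - f (pmf p b))"
    using on_ab[of "\<lambda>x z. z * c x - f z"]
    by (simp add: separable_objective_def p' sum_subtractf sum.distrib wab algebra_simps)
  finally have le: "t * (c a - c b) \<le> (f (pmf p a + t) - f (pmf p a)) + (f (pmf p b - t) - f (pmf p b))"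
    by simp
  have "pmf p a + t \<in> {0<..1}" "pmf p b - t \<in> {0<..1}"
    using t pmf_add_le_1[OF ab, of p] pmf_le_1[of p b] by (auto simp: add_nonneg_pos)
  from this[THEN Ioc_interior]
  have "f (pmf p a + t) - f (pmf p a) \<le> t * g (pmf p a + t)"
    and "f (pmf p b - t) - f (pmf p b) \<le> - t * g (pmf p b - t)"
    using tangent_below[of "pmf p a + t" "pmf p a"] tangent_below[of "pmf p b - t" "pmf p b"]
    by (simp_all add: pmf_in_edom mult.commute)
  with le have "t * (c a - c b) \<le> t * (g (pmf p a + t) - g (pmf p b - t))"
    by (simp add: algebra_simps)
  then show ?thesis using t by simp
qed

text \<open>If some coordinate were zero, moving a small mass \<open>t\<close> onto it would gain \<open>- \<psi>' t\<close> per unit mass, which is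
  arbitrarily large as \<open>t\<close> tends to \<open>0\<close>.\<close>

lemma maximizer_pos:
  fixes p :: "'a::finite pmf"
  assumes max: "\<And>p'. separable_objective c p' \<le> separable_objective c p"
  shows "0 < pmf p a"
proof (rule ccontr)
  assume "\<not> 0 < pmf p a"
  then have a0: "pmf p a = 0" using pmf_nonneg[of p a] by linarith
  obtain b where b: "0 < pmf p b"
    by (metis pmf_positive set_pmf_not_empty ex_in_conv)
  have ab: "a \<noteq> b" using a0 b by auto
  obtain x where x: "x \<in> {0<..1}" "g x < c a - c b + g (pmf p b / 2)"
    using g_unbounded_below by blast
  define t where "t = min x (pmf p b / 2)"
  have t: "0 < t" "t < pmf p b" "t \<le> x" "t \<le> pmf p b / 2" using x b by (auto simp: t_def)
  have "c a - g t \<le> c b - g (pmf p b - t)"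
    using maximizer_transfer[OF max ab t(1,2)] a0 by simp
  moreover have "g t \<le> g x" using t x by (intro g_mono) auto
  moreover have "g (pmf p b / 2) \<le> g (pmf p b - t)"
    using t b pmf_le_1[of p b] by (intro g_mono) auto
  ultimately show False using x(2) by linarith
qed

text \<open>Let the transferred mass tend to zero.\<close>

lemma maximizer_stationary_le:
  fixes p :: "'a::finite pmf"
  assumes max: "\<And>p'. separable_objective c p' \<le> separable_objective c p"
  shows "c a - g (pmf p a) \<le> c b - g (pmf p b)"
proof (cases "a = b")
  case False
  have cont: "isCont g (pmf p x)" for x
    using maximizer_pos[OF max] pmf_le_1 by (intro isCont_g Ioc_interior) auto
  show ?thesis
  proof (rule tendsto_le)
    have "((\<lambda>t. g (pmf p a + t)) \<longlongrightarrow> g (pmf p a)) (at_right 0)"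
      by (rule isCont_tendsto_compose[OF cont]) (auto intro!: tendsto_eq_intros)
    then show "((\<lambda>t. c a - g (pmf p a + t)) \<longlongrightarrow> c a - g (pmf p a)) (at_right 0)"
      by (intro tendsto_intros)
    have "((\<lambda>t. g (pmf p b - t)) \<longlongrightarrow> g (pmf p b)) (at_right 0)"
      by (rule isCont_tendsto_compose[OF cont]) (auto intro!: tendsto_eq_intros)
    then show "((\<lambda>t. c b - g (pmf p b - t)) \<longlongrightarrow> c b - g (pmf p b)) (at_right 0)"
      by (intro tendsto_intros)
    show "\<forall>\<^sub>F t in at_right 0. c a - g (pmf p a + t) \<le> c b - g (pmf p b - t)"
    proof (rule eventually_at_rightI[OF _ maximizer_pos[OF max]])
      fix t assume "t \<in> {0<..<pmf p b}"
      then show "c a - g (pmf p a + t) \<le> c b - g (pmf p b - t)"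
        using maximizer_transfer[OF max False, of t] by simp
    qed
  qed simp
qed simp

end

section \<open>Convergence of the values\<close>

locale pmd_run = steep_mirror_map \<psi>
  for \<psi> :: "real \<Rightarrow> ereal" +
  fixes M :: "('s::finite, 'a::finite) mdp" and \<eta> :: real and \<pi> :: "nat \<Rightarrow> ('s, 'a) policy"
  assumes valid: "valid_mdp M" and eta_pos: "0 < \<eta>" and pmd: "pmd M \<psi> \<eta> \<pi>"
begin

lemma pmd_maximizer:
  "separable_objective (\<lambda>a. \<eta> * Q M (\<pi> k) s a + g (pmf (\<pi> k s) a)) p
    \<le> separable_objective (\<lambda>a. \<eta> * Q M (\<pi> k) s a + g (pmf (\<pi> k s) a)) (\<pi> (Suc k) s)"
  using pmd unfolding pmd_def is_arg_max_def mirror_step_objective by (auto simp: not_less)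

lemma policy_pos: "0 < pmf (\<pi> k s) a"
proof (cases k)
  case 0
  have "pmf (\<pi> 0 s) a \<in> interior (edom \<psi>)" using pmd by (simp add: pmd_def)
  then have "pmf (\<pi> 0 s) a \<noteq> 0" using zero_notin_interior by metis
  then show ?thesis using 0 pmf_nonneg[of "\<pi> 0 s" a] by simp
next
  case (Suc j)
  then show ?thesis using maximizer_pos[OF pmd_maximizer] by simp
qed

lemma policy_in: "pmf (\<pi> k s) a \<in> {0<..1}"
  using policy_pos pmf_le_1 by auto

lemma stationary:
  "g (pmf (\<pi> (Suc k) s) a) - g (pmf (\<pi> (Suc k) s) b) =
   g (pmf (\<pi> k s) a) - g (pmf (\<pi> k s) b) + \<eta> * (Q M (\<pi> k) s a - Q M (\<pi> k) s b)"
  using maximizer_stationary_le[OF pmd_maximizer[of k s], of a b]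
    maximizer_stationary_le[OF pmd_maximizer[of k s], of b a]
  by (simp add: algebra_simps)

lemma dpsi_diff_sum:
  "g (pmf (\<pi> (k + n) s) a) - g (pmf (\<pi> (k + n) s) b) =
   g (pmf (\<pi> k s) a) - g (pmf (\<pi> k s) b) + \<eta> * (\<Sum>t<n. Q M (\<pi> (k + t)) s a - Q M (\<pi> (k + t)) s b)"
  by (induction n) (simp_all add: stationary algebra_simps)

text \<open>Since \<open>\<eta> * Q\<^sub>k(s, \<cdot>)\<close> equals the change of \<open>\<psi>'\<close> along the step up to a constant \<open>l\<close>, and both policies
  have total mass \<open>1\<close>, \<open>\<eta>\<close> times the increase of the average Q-value is a sum of products of
  increments of the probabilities and of the monotone function \<open>\<psi>'\<close> at them. So the old value function is a subsolution for the new policy.\<close>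

lemma V_step_mono: "V M (\<pi> k) s \<le> V M (\<pi> (Suc k)) s"
proof (rule subsolution_le_V[OF valid])
  fix s
  let ?p = "pmf (\<pi> k s)" and ?p' = "pmf (\<pi> (Suc k) s)" and ?Q = "Q M (\<pi> k) s"
  \<comment> \<open>Any action serves as reference for the common shift \<open>l\<close> of \<open>\<psi>'\<close>.\<close>
  obtain b :: 'a where True by simp
  define l where "l = g (?p' b) - g (?p b) - \<eta> * ?Q b"
  have foc: "\<eta> * ?Q a = g (?p' a) - g (?p a) - l" for a
    using stationary[of k s a b] by (simp add: l_def algebra_simps)
  have "0 \<le> (?p' a - ?p a) * (g (?p' a) - g (?p a))" for a
    using g_mono[of "?p a" "?p' a"] g_mono[of "?p' a" "?p a"] policy_in[of k s a] policy_in[of "Suc k" s a]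
    by (cases "?p a \<le> ?p' a") (auto intro: mult_nonneg_nonneg mult_nonpos_nonpos)
  then have "0 \<le> (\<Sum>a\<in>UNIV. (?p' a - ?p a) * (g (?p' a) - g (?p a))) - l * (\<Sum>a\<in>UNIV. ?p' a - ?p a)"
    by (simp add: sum_nonneg sum_subtractf sum_pmf_UNIV)
  also have "\<dots> = (\<Sum>a\<in>UNIV. (?p' a - ?p a) * (\<eta> * ?Q a))"
    by (simp only: foc right_diff_distrib[of _ _ l] mult.commute[of _ l] sum_subtractf sum_distrib_left[symmetric])
  also have "\<dots> = \<eta> * (\<Sum>a\<in>UNIV. (?p' a - ?p a) * ?Q a)"
    by (simp add: sum_distrib_left mult_ac)
  finally have "0 \<le> (\<Sum>a\<in>UNIV. (?p' a - ?p a) * ?Q a)"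
    using eta_pos by (simp add: zero_le_mult_iff)
  then show "V M (\<pi> k) s \<le> (\<Sum>a\<in>UNIV. ?p' a * backup M (V M (\<pi> k)) s a)"
    by (simp add: V_eq_sum_Q[OF valid, of _ s] Q_eq_backup[OF valid, symmetric] left_diff_distrib sum_subtractf)
qed

definition Vlim :: "'s \<Rightarrow> real" where
  "Vlim s = (SUP k. V M (\<pi> k) s)"

lemma V_tendsto_Vlim: "(\<lambda>k. V M (\<pi> k) s) \<longlonglongrightarrow> Vlim s"
  unfolding Vlim_def using V_bounds[OF valid] V_step_mono
  by (intro LIMSEQ_incseq_SUP bdd_aboveI2[where M = "1 / (1 - discount M)"] incseq_SucI)

lemma Q_tendsto_backup_Vlim: "(\<lambda>k. Q M (\<pi> k) s a) \<longlonglongrightarrow> backup M Vlim s a"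
  unfolding Q_eq_backup[OF valid] backup_def by (intro tendsto_intros V_tendsto_Vlim)

text \<open>Eventually the Q-value of \<open>a\<close> exceeds that of \<open>b\<close> by a fixed amount, so the gap of \<open>\<psi>'\<close> between them grows
  at least linearly; as \<open>\<psi>'\<close> is at most \<open>\<psi>' 1\<close> at \<open>a\<close>, it falls at least linearly at \<open>b\<close>.\<close>

lemma summable_dominated_action:
  assumes "backup M Vlim s b < backup M Vlim s a"
  shows "summable (\<lambda>k. pmf (\<pi> k s) b)"
proof -
  define d where "d = (backup M Vlim s a - backup M Vlim s b) / 2"
  have d: "0 < d" using assms by (simp add: d_def)
  have "(\<lambda>k. Q M (\<pi> k) s a - Q M (\<pi> k) s b) \<longlonglongrightarrow> backup M Vlim s a - backup M Vlim s b"
    by (intro tendsto_intros Q_tendsto_backup_Vlim)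
  then have "\<forall>\<^sub>F k in sequentially. d < Q M (\<pi> k) s a - Q M (\<pi> k) s b"
    by (rule order_tendstoD) (use assms in \<open>simp add: d_def field_simps\<close>)
  then obtain K where K: "\<And>k. K \<le> k \<Longrightarrow> d \<le> Q M (\<pi> k) s a - Q M (\<pi> k) s b"
    unfolding eventually_sequentially by (meson less_imp_le)
  define D where "D = g (pmf (\<pi> K s) a) - g (pmf (\<pi> K s) b)"
  show ?thesis
  proof (rule summable_of_dpsi_linear_decay[OF policy_in])
    show "0 < \<eta> * d" using eta_pos d by simp
    fix k assume "K \<le> k"
    then obtain n where k: "k = K + n" using le_Suc_ex by blast
    have "real n * d \<le> (\<Sum>t<n. Q M (\<pi> (K + t)) s a - Q M (\<pi> (K + t)) s b)"
      using sum_bounded_below[of "{..<n}" d "\<lambda>t. Q M (\<pi> (K + t)) s a - Q M (\<pi> (K + t)) s b"] K by simp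
    then have "\<eta> * (real n * d) \<le> g (pmf (\<pi> k s) a) - g (pmf (\<pi> k s) b) - D"
      unfolding k dpsi_diff_sum D_def using eta_pos by simp
    moreover have "g (pmf (\<pi> k s) a) \<le> g 1"
      using policy_in[of k s a] by (intro g_mono) auto
    ultimately show "g (pmf (\<pi> k s) b) \<le> (g 1 - D + \<eta> * d * real K) - \<eta> * d * real k"
      by (simp add: k algebra_simps)
  qed
qed

text \<open>In the average of \<open>m - Q\<^sub>k(s, a)\<close> under \<open>\<pi>\<^sub>k\<close>, which is \<open>m - V\<^sub>k(s)\<close>, every term vanishes in the limit: for
  actions that attain the maximum the second factor tends to zero, for the others the probability does.\<close>

lemma Vlim_eq_Max: "Vlim s = (MAX a. backup M Vlim s a)"
proof -
  let ?B = "backup M Vlim s"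
  define m where "m = (MAX a. ?B a)"
  have le: "?B a \<le> m" for a by (simp add: m_def)
  have "(\<lambda>k. pmf (\<pi> k s) a * (m - Q M (\<pi> k) s a)) \<longlonglongrightarrow> 0" for a
  proof (cases "?B a = m")
    case True
    have lim: "(\<lambda>k. \<bar>m - Q M (\<pi> k) s a\<bar>) \<longlonglongrightarrow> 0"
      using tendsto_rabs[OF tendsto_diff[OF tendsto_const Q_tendsto_backup_Vlim], of m s a] True by simp
    show ?thesis
      by (rule Lim_null_comparison[OF always_eventually lim])
         (simp add: abs_mult pmf_le_1 mult_left_le_one_le)
  next
    case False
    have "m \<in> range ?B" unfolding m_def by (rule Max_in) auto
    then obtain b where "?B b = m" by blast
    then have "?B a < ?B b" using le[of a] False by simp
    from summable_LIMSEQ_zero[OF summable_dominated_action[OF this]]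
    have "(\<lambda>k. pmf (\<pi> k s) a * (m - Q M (\<pi> k) s a)) \<longlonglongrightarrow> 0 * (m - ?B a)"
      by (intro tendsto_intros Q_tendsto_backup_Vlim)
    then show ?thesis by simp
  qed
  then have "(\<lambda>k. \<Sum>a\<in>UNIV. pmf (\<pi> k s) a * (m - Q M (\<pi> k) s a)) \<longlonglongrightarrow> (\<Sum>a\<in>(UNIV :: 'a set). 0)"
    by (rule tendsto_sum)
  moreover have "(\<Sum>a\<in>UNIV. pmf (\<pi> k s) a * (m - Q M (\<pi> k) s a)) = m - V M (\<pi> k) s" for k
    by (simp add: V_eq_sum_Q[OF valid] right_diff_distrib sum_subtractf sum_distrib_right[symmetric] sum_pmf_UNIV)
  ultimately have "(\<lambda>k. m - V M (\<pi> k) s) \<longlonglongrightarrow> 0" by simp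
  moreover have "(\<lambda>k. m - V M (\<pi> k) s) \<longlonglongrightarrow> m - Vlim s"
    by (intro tendsto_intros V_tendsto_Vlim)
  ultimately show ?thesis using LIMSEQ_unique unfolding m_def by fastforce
qed

text \<open>A solution of the Bellman optimality equation is a supersolution for every policy.\<close>

lemma V_le_Vlim: "V M p s \<le> Vlim s"
proof (rule V_le_supersolution[OF valid])
  show "(\<Sum>a\<in>UNIV. pmf (p s) a * backup M Vlim s a) \<le> Vlim s" for s
    by (intro pmf_average_le, subst Vlim_eq_Max) simp
qed

lemma Vstar_eq_Vlim: "Vstar M = Vlim"
proof
  fix s
  have bdd: "bdd_above (range (\<lambda>p. V M p s))" by (intro bdd_aboveI2[where M = "Vlim s"] V_le_Vlim)
  show "Vstar M s = Vlim s"
    unfolding Vstar_def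
  proof (rule antisym)
    show "(SUP p. V M p s) \<le> Vlim s" by (intro cSUP_least V_le_Vlim) simp
    show "Vlim s \<le> (SUP p. V M p s)"
      by (rule LIMSEQ_le_const2[OF V_tendsto_Vlim]) (use cSUP_upper[OF UNIV_I bdd] in blast)
  qed
qed

lemma Q_le_backup_Vstar: "Q M p s a \<le> backup M (Vstar M) s a"
  unfolding Q_eq_backup[OF valid] Vstar_eq_Vlim by (intro backup_mono[OF valid] V_le_Vlim)

lemma Qstar_eq_backup: "Qstar M s a = backup M (Vstar M) s a"
  unfolding Qstar_def
proof (rule antisym)
  have bdd: "bdd_above (range (\<lambda>p. Q M p s a))"
    by (intro bdd_aboveI2[where M = "backup M (Vstar M) s a"] Q_le_backup_Vstar)
  show "(SUP p. Q M p s a) \<le> backup M (Vstar M) s a" by (intro cSUP_least Q_le_backup_Vstar) simp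
  show "backup M (Vstar M) s a \<le> (SUP p. Q M p s a)"
    unfolding Vstar_eq_Vlim
    by (rule LIMSEQ_le_const2[OF Q_tendsto_backup_Vlim]) (use cSUP_upper[OF UNIV_I bdd] in blast)
qed

lemma Vstar_eq_Max: "Vstar M s = (MAX a. Qstar M s a)"
  unfolding Qstar_eq_backup unfolding Vstar_eq_Vlim by (rule Vlim_eq_Max)

lemma Qstar_le_Vstar: "Qstar M s a \<le> Vstar M s"
  by (simp add: Vstar_eq_Max)

lemma opt_actions_nonempty: "opt_actions M s \<noteq> {}"
proof -
  have "Vstar M s \<in> range (Qstar M s)" unfolding Vstar_eq_Max by (rule Max_in) auto
  then obtain a where "Vstar M s = Qstar M s a" by blast
  then show ?thesis unfolding opt_actions_def by (intro ex_in_conv[THEN iffD1] exI[of _ a]) simp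
qed

lemma summable_suboptimal_action:
  assumes "a \<notin> opt_actions M s"
  shows "summable (\<lambda>k. pmf (\<pi> k s) a)"
proof -
  obtain b where "b \<in> opt_actions M s" using opt_actions_nonempty by blast
  then have "Qstar M s a < Qstar M s b"
    using assms Qstar_le_Vstar[of s a] by (auto simp: opt_actions_def)
  then show ?thesis
    by (intro summable_dominated_action) (simp add: Qstar_eq_backup Vstar_eq_Vlim)
qed

lemma V_le_Vstar: "V M p s \<le> Vstar M s"
  by (simp add: Vstar_eq_Vlim V_le_Vlim)

lemma Q_le_Qstar: "Q M p s a \<le> Qstar M s a"
  by (simp add: Qstar_eq_backup Q_le_backup_Vstar)

lemma Vstar_minus_V_le_V_err: "Vstar M s - V M p s \<le> V_err M p"
proof -
  have "\<bar>Vstar M s - V M p s\<bar> \<le> V_err M p"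
    unfolding V_err_def sup_norm_def by (rule Max_ge) auto
  then show ?thesis by simp
qed

lemma V_err_attained: "\<exists>s. V_err M p = Vstar M s - V M p s"
proof -
  have "V_err M p \<in> range (\<lambda>s. \<bar>Vstar M s - V M p s\<bar>)"
    unfolding V_err_def sup_norm_def by (rule Max_in) auto
  then show ?thesis using V_le_Vstar by (auto simp: abs_of_nonneg)
qed

lemma V_err_nonneg: "0 \<le> V_err M p"
  using V_err_attained[of p] V_le_Vstar by fastforce

lemma Qstar_minus_Q_le: "Qstar M s a - Q M p s a \<le> discount M * V_err M p"
  unfolding Qstar_eq_backup Q_eq_backup[OF valid]
  by (intro backup_diff_le[OF valid] Vstar_minus_V_le_V_err)

lemma Q_ge: "Qstar M s a - V_err M p \<le> Q M p s a"
proof -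
  have "discount M * V_err M p \<le> V_err M p"
    using discount_bounds[OF valid] V_err_nonneg[of p] by (simp add: mult_left_le_one_le)
  then show ?thesis using Qstar_minus_Q_le[of s a p] by linarith
qed

lemma V_err_antimono: "j \<le> k \<Longrightarrow> V_err M (\<pi> k) \<le> V_err M (\<pi> j)"
proof -
  assume "j \<le> k"
  obtain s where s: "V_err M (\<pi> k) = Vstar M s - V M (\<pi> k) s" using V_err_attained by blast
  have "V M (\<pi> j) s \<le> V M (\<pi> k) s"
    by (rule lift_Suc_mono_le[where f = "\<lambda>k. V M (\<pi> k) s"]) (simp_all add: V_step_mono \<open>j \<le> k\<close>)
  then show ?thesis using s Vstar_minus_V_le_V_err[of s "\<pi> j"] by linarith
qed

lemma subopt_mass_bounds: "0 \<le> subopt_mass M p s" "a \<notin> opt_actions M s \<Longrightarrow> pmf (p s) a \<le> subopt_mass M p s"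
  unfolding subopt_mass_def by (auto intro!: sum_nonneg member_le_sum)

lemma sum_opt_actions: "(\<Sum>a\<in>opt_actions M s. pmf (p s) a) = 1 - subopt_mass M p s"
proof -
  have "(\<Sum>a\<in>UNIV. pmf (p s) a) = (\<Sum>a\<in>opt_actions M s. pmf (p s) a) + subopt_mass M p s"
    unfolding subopt_mass_def
    using sum.union_disjoint[of "opt_actions M s" "- opt_actions M s" "pmf (p s)"] by simp
  then show ?thesis by (simp add: sum_pmf_UNIV)
qed

lemma summable_subopt_mass: "summable (\<lambda>k. subopt_mass M (\<pi> k) s)"
  unfolding subopt_mass_def by (intro summable_sum summable_suboptimal_action) simp

text \<open>Split \<open>V\<^sup>* - V\<close> at a worst state into the loss of one suboptimal choice, which is at most
  \<open>1 / (1 - \<gamma>)\<close> on the suboptimal mass, and the discounted error at the next state, which the left-hand side absorbs.\<close>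

lemma V_err_le_subopt_mass:
  "V_err M p \<le> (1 / (1 - discount M))\<^sup>2 * (\<Sum>s\<in>UNIV. subopt_mass M p s)"
proof -
  let ?\<gamma> = "discount M"
  have g: "0 < 1 - ?\<gamma>" using discount_bounds[OF valid] by simp
  have inv_square: "v \<le> (1 / c)\<^sup>2 * m" if "0 < c" "c * v \<le> 1 / c * m" for c v m :: real
    using that by (simp add: field_simps power2_eq_square)
  obtain s where s: "V_err M p = Vstar M s - V M p s" using V_err_attained by blast
  have Vs: "Vstar M s \<le> 1 / (1 - ?\<gamma>)"
    unfolding Vstar_def by (intro cSUP_least V_bounds[OF valid]) simp
  have "pmf (p s) a * (Vstar M s - Qstar M s a) \<le> (if a \<in> opt_actions M s then 0 else pmf (p s) a * (1 / (1 - ?\<gamma>)))" for a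
  proof -
    have "0 \<le> Q M p s a"
      unfolding Q_eq_backup[OF valid] backup_def
      by (intro add_nonneg_nonneg mult_nonneg_nonneg sum_nonneg reward_bounds[OF valid] discount_bounds[OF valid] V_bounds[OF valid]) simp
    then have "Vstar M s - Qstar M s a \<le> 1 / (1 - ?\<gamma>)" using Q_le_Qstar[of p s a] Vs by linarith
    then show ?thesis by (auto simp: opt_actions_def intro!: mult_left_mono simp del: times_divide_eq_right)
  qed
  then have "(\<Sum>a\<in>UNIV. pmf (p s) a * (Vstar M s - Qstar M s a)) \<le> (\<Sum>a\<in>UNIV. if a \<in> opt_actions M s then 0 else pmf (p s) a * (1 / (1 - ?\<gamma>)))"
    by (intro sum_mono)
  also have "\<dots> = 1 / (1 - ?\<gamma>) * subopt_mass M p s"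
    by (simp add: sum.If_cases subopt_mass_def sum_divide_distrib Compl_eq)
  finally have "(\<Sum>a\<in>UNIV. pmf (p s) a * (Vstar M s - Qstar M s a)) \<le> 1 / (1 - ?\<gamma>) * subopt_mass M p s" .
  moreover have "(\<Sum>a\<in>UNIV. pmf (p s) a * (Qstar M s a - Q M p s a)) \<le> ?\<gamma> * V_err M p"
    by (intro pmf_average_le Qstar_minus_Q_le)
  moreover have "Vstar M s - V M p s = (\<Sum>a\<in>UNIV. pmf (p s) a * (Vstar M s - Qstar M s a)) + (\<Sum>a\<in>UNIV. pmf (p s) a * (Qstar M s a - Q M p s a))"
    by (simp add: V_eq_sum_Q[OF valid] right_diff_distrib sum_subtractf sum_distrib_right[symmetric] sum_pmf_UNIV)
  ultimately have "(1 - ?\<gamma>) * V_err M p \<le> 1 / (1 - ?\<gamma>) * subopt_mass M p s"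
    using s unfolding left_diff_distrib by linarith
  then have "V_err M p \<le> (1 / (1 - ?\<gamma>))\<^sup>2 * subopt_mass M p s"
    by (rule inv_square[OF g])
  also have "\<dots> \<le> (1 / (1 - ?\<gamma>))\<^sup>2 * (\<Sum>s\<in>UNIV. subopt_mass M p s)"
    by (intro mult_left_mono member_le_sum subopt_mass_bounds) auto
  finally show ?thesis .
qed

lemma summable_V_err: "summable (\<lambda>k. V_err M (\<pi> k))"
proof (rule summable_comparison_test'[where N = 0])
  show "summable (\<lambda>k. (1 / (1 - discount M))\<^sup>2 * (\<Sum>s\<in>UNIV. subopt_mass M (\<pi> k) s))"
    by (intro summable_mult summable_sum summable_subopt_mass)
  show "norm (V_err M (\<pi> n)) \<le> (1 / (1 - discount M))\<^sup>2 * (\<Sum>s\<in>UNIV. subopt_mass M (\<pi> n) s)" for n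
    using V_err_le_subopt_mass[of "\<pi> n"] V_err_nonneg[of "\<pi> n"] by simp
qed

lemma V_err_le_after_T_iter:
  assumes "0 < \<sigma>" "T_iter M \<pi> \<sigma> \<le> k"
  shows "V_err M (\<pi> k) \<le> \<sigma>"
proof -
  have "\<forall>\<^sub>F k in sequentially. V_err M (\<pi> k) < \<sigma>"
    using summable_LIMSEQ_zero[OF summable_V_err] assms(1) by (rule order_tendstoD)
  then obtain j where "V_err M (\<pi> j) \<le> \<sigma>" by (auto simp: eventually_sequentially intro: less_imp_le)
  then have "V_err M (\<pi> (T_iter M \<pi> \<sigma>)) \<le> \<sigma>" unfolding T_iter_def by (rule LeastI)
  then show ?thesis using V_err_antimono[OF assms(2)] by linarith
qed

end

section \<open>Convergence of the policies\<close>

text \<open>The interval starts at half of the least positive mass of \<open>p\<close>: for \<open>p = \<pi>\<^sub>\<infinity>(\<cdot>|s)\<close> this is a neighbourhood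
  in \<open>(0, 1]\<close> of all the limiting probabilities of optimal actions, so it eventually contains their iterates.\<close>

definition least_curvature :: "'a::finite pmf \<Rightarrow> (real \<Rightarrow> real) \<Rightarrow> real" where
  "least_curvature p \<phi> = Inf (\<phi> ` {Min (pmf p ` set_pmf p) / 2..1})"

definition greatest_curvature :: "'a::finite pmf \<Rightarrow> (real \<Rightarrow> real) \<Rightarrow> real" where
  "greatest_curvature p \<phi> = Sup (\<phi> ` {Min (pmf p ` set_pmf p) / 2..1})"

lemma half_least_mass:
  fixes p :: "'c::finite pmf"
  shows "Min (pmf p ` set_pmf p) / 2 \<in> {0<..1}"
    and "a \<in> set_pmf p \<Longrightarrow> Min (pmf p ` set_pmf p) / 2 < pmf p a"
proof -
  have "Min (pmf p ` set_pmf p) \<in> pmf p ` set_pmf p"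
    by (intro Min_in) (auto simp: set_pmf_not_empty)
  then have pos: "0 < Min (pmf p ` set_pmf p)" and le1: "Min (pmf p ` set_pmf p) \<le> 1"
    by (auto simp: pmf_positive pmf_le_1)
  from pos le1 show "Min (pmf p ` set_pmf p) / 2 \<in> {0<..1}" by simp
  show "Min (pmf p ` set_pmf p) / 2 < pmf p a" if "a \<in> set_pmf p"
  proof -
    have "Min (pmf p ` set_pmf p) \<le> pmf p a" using that by (intro Min_le) auto
    with pos show ?thesis by linarith
  qed
qed

lemma ex_mass_ge_uniform:
  fixes p :: "'c::finite pmf"
  shows "\<exists>x. 1 / real CARD('c) \<le> pmf p x"
proof (rule ccontr)
  assume "\<not> ?thesis"
  then have "(\<Sum>x\<in>UNIV. pmf p x) < (\<Sum>x\<in>(UNIV :: 'c set). 1 / real CARD('c))"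
    by (intro sum_strict_mono) (auto simp: not_le)
  then show False by (simp add: sum_pmf_UNIV)
qed

lemma sup_norm_le: "(\<And>x. \<bar>w x\<bar> \<le> c) \<Longrightarrow> sup_norm w \<le> c"
  unfolding sup_norm_def by (subst Max_le_iff) auto

context steep_mirror_map
begin

lemma curvature_bounds:
  assumes l: "l \<in> {0<..1}"
  shows "0 < Inf (ddpsi \<psi> ` {l..1})"
    and "z \<in> {l..1} \<Longrightarrow> Inf (ddpsi \<psi> ` {l..1}) \<le> ddpsi \<psi> z"
    and "z \<in> {l..1} \<Longrightarrow> ddpsi \<psi> z \<le> Sup (ddpsi \<psi> ` {l..1})"
proof -
  have sub: "{l..1} \<subseteq> interior (edom \<psi>)" using l Ioc_interior by auto
  have cont: "continuous_on {l..1} (ddpsi \<psi>)"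
    using ddpsi_continuous sub by (rule continuous_on_subset)
  have bnd: "bounded (ddpsi \<psi> ` {l..1})"
    by (intro compact_imp_bounded compact_continuous_image cont compact_Icc)
  obtain z0 where z0: "z0 \<in> {l..1}" "\<And>z. z \<in> {l..1} \<Longrightarrow> ddpsi \<psi> z0 \<le> ddpsi \<psi> z"
    using continuous_attains_inf[OF compact_Icc _ cont] l by auto
  have "ddpsi \<psi> z0 \<le> Inf (ddpsi \<psi> ` {l..1})"
    by (intro cINF_greatest z0(2)) (use l in auto)
  moreover have "0 < ddpsi \<psi> z0" using z0(1) sub ddpsi_pos by blast
  ultimately show "0 < Inf (ddpsi \<psi> ` {l..1})" by linarith
  show "Inf (ddpsi \<psi> ` {l..1}) \<le> ddpsi \<psi> z" if "z \<in> {l..1}"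
    by (intro cINF_lower that bounded_imp_bdd_below bnd)
  show "ddpsi \<psi> z \<le> Sup (ddpsi \<psi> ` {l..1})" if "z \<in> {l..1}"
    by (intro cSUP_upper that bounded_imp_bdd_above bnd)
qed

lemma dpsi_increment_ge:
  assumes l: "0 < l" and L: "\<And>z. z \<in> {l..1} \<Longrightarrow> L \<le> ddpsi \<psi> z"
    and "l \<le> x" "x \<le> y" "y \<le> 1"
  shows "L * (y - x) \<le> g y - g x"
proof (cases "x = y")
  case False
  then have "x < y" using assms(4) by simp
  moreover have "DERIV g z :> ddpsi \<psi> z" if "x \<le> z" "z \<le> y" for z
    using that assms by (intro DERIV_g Ioc_interior) auto
  ultimately obtain z where z: "x < z" "z < y" "g y - g x = (y - x) * ddpsi \<psi> z"
    using MVT2[of x y g "ddpsi \<psi>"] by blast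
  have "(y - x) * L \<le> (y - x) * ddpsi \<psi> z"
    using z assms by (intro mult_left_mono L) auto
  then show ?thesis by (simp add: z(3) mult.commute)
qed simp

text \<open>If some coordinate \<open>b\<close> goes the other way, \<open>\<psi>'\<close> at \<open>a\<close> grows by at most \<open>e\<close>, and
  the curvature bound turns this into a bound on the change of \<open>a\<close>. Otherwise there is no cancellation in the
  total change, which dominates each single one.\<close>

lemma balanced_displacement_le:
  fixes x y :: "'b \<Rightarrow> real"
  assumes A: "finite A" "a \<in> A" and l: "0 < l" and L: "0 < L" "\<And>z. z \<in> {l..1} \<Longrightarrow> L \<le> ddpsi \<psi> z"
    and x: "\<And>b. b \<in> A \<Longrightarrow> x b \<in> {l..1}" and y: "\<And>b. b \<in> A \<Longrightarrow> y b \<in> {l..1}"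
    and e: "\<And>b. b \<in> A \<Longrightarrow> (g (x a) - g (y a)) - (g (x b) - g (y b)) \<le> e"
  shows "x a - y a \<le> max (e / L) \<bar>(\<Sum>b\<in>A. x b) - (\<Sum>b\<in>A. y b)\<bar>"
proof (cases "\<exists>b\<in>A. x b < y b")
  case True
  then obtain b where b: "b \<in> A" "x b < y b" by blast
  have "g (x b) < g (y b)" using b x[of b] y[of b] l by (intro g_less) auto
  with e[OF b(1)] have ge: "g (x a) - g (y a) \<le> e" by linarith
  have "L * (x a - y a) \<le> e"
  proof (cases "y a \<le> x a")
    case True
    have "L * (x a - y a) \<le> g (x a) - g (y a)"
      by (rule dpsi_increment_ge[OF l L(2)]) (use True x[OF A(2)] y[OF A(2)] in auto)
    with ge show ?thesis by linarith
  next
    case False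
    have "0 \<le> e" using e[OF A(2)] by simp
    moreover have "L * (x a - y a) \<le> 0" using False L(1) by (simp add: mult_le_0_iff)
    ultimately show ?thesis by linarith
  qed
  then have "x a - y a \<le> e / L" using L(1) by (simp add: field_simps)
  then show ?thesis by simp
next
  case False
  then have "x a - y a \<le> (\<Sum>b\<in>A. x b - y b)"
    using A by (intro member_le_sum) (auto simp: not_less)
  then show ?thesis by (simp add: sum_subtractf)
qed

end

context pmd_run
begin

definition err_tail :: "nat \<Rightarrow> real" where
  "err_tail k = (\<Sum>t. V_err M (\<pi> (k + t)))"

lemma summable_err_tail: "summable (\<lambda>t. V_err M (\<pi> (k + t)))"
  using summable_ignore_initial_segment[OF summable_V_err, of k] by (simp add: add.commute)

lemma err_tail_tendsto: "err_tail \<longlonglongrightarrow> 0"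
proof -
  have "err_tail = (\<lambda>k. (\<Sum>t. V_err M (\<pi> t)) - (\<Sum>t<k. V_err M (\<pi> t)))"
    unfolding err_tail_def
    using suminf_minus_initial_segment[OF summable_V_err] by (simp add: add.commute fun_eq_iff)
  moreover have "(\<lambda>k. (\<Sum>t. V_err M (\<pi> t)) - (\<Sum>t<k. V_err M (\<pi> t)))
      \<longlonglongrightarrow> (\<Sum>t. V_err M (\<pi> t)) - (\<Sum>t. V_err M (\<pi> t))"
    by (intro tendsto_intros summable_LIMSEQ summable_V_err)
  ultimately show ?thesis by simp
qed

text \<open>The Q-value of an optimal action never falls short of any other Q-value by more than the value error.\<close>

lemma opt_action_dpsi_gap:
  assumes "a \<in> opt_actions M s"
  shows "g (pmf (\<pi> k s) a) - g (pmf (\<pi> k s) b) - \<eta> * err_tail k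
    \<le> g (pmf (\<pi> (k + n) s) a) - g (pmf (\<pi> (k + n) s) b)"
proof -
  have "- V_err M (\<pi> (k + t)) \<le> Q M (\<pi> (k + t)) s a - Q M (\<pi> (k + t)) s b" for t
    using assms Q_ge[of s a "\<pi> (k + t)"] Q_le_Qstar[of "\<pi> (k + t)" s b] Qstar_le_Vstar[of s b]
    by (simp add: opt_actions_def)
  then have "(\<Sum>t<n. - V_err M (\<pi> (k + t))) \<le> (\<Sum>t<n. Q M (\<pi> (k + t)) s a - Q M (\<pi> (k + t)) s b)"
    by (rule sum_mono)
  moreover have "(\<Sum>t<n. V_err M (\<pi> (k + t))) \<le> err_tail k"
    unfolding err_tail_def by (intro sum_le_suminf summable_err_tail) (auto simp: V_err_nonneg)
  ultimately have "- err_tail k \<le> (\<Sum>t<n. Q M (\<pi> (k + t)) s a - Q M (\<pi> (k + t)) s b)"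
    by (simp add: sum_negf)
  then have "\<eta> * (- err_tail k) \<le> \<eta> * (\<Sum>t<n. Q M (\<pi> (k + t)) s a - Q M (\<pi> (k + t)) s b)"
    using eta_pos by (intro mult_left_mono) auto
  then show ?thesis unfolding dpsi_diff_sum by simp
qed

text \<open>At every iteration some action \<open>b\<close> has at least the uniform probability, and by \<open>opt_action_dpsi_gap\<close>
  \<open>\<psi>'\<close> at an optimal action can lag behind \<open>\<psi>'\<close> at \<open>b\<close> only by a constant.\<close>

lemma opt_action_mass_bounded_below:
  "\<exists>l\<in>{0<..1}. \<forall>k. \<forall>a\<in>opt_actions M s. l \<le> pmf (\<pi> k s) a"
proof -
  define m where "m = Min (range (pmf (\<pi> 0 s)))"
  have "m \<in> range (pmf (\<pi> 0 s))" unfolding m_def by (rule Min_in) auto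
  then have m: "m \<in> {0<..1}" using policy_in by auto
  have m_le: "m \<le> pmf (\<pi> 0 s) a" for a unfolding m_def by simp
  let ?u = "1 / real CARD('a)"
  have u: "?u \<in> {0<..1}" by (simp add: Suc_le_eq)
  obtain l where l: "l \<in> {0<..1}" "g l < g ?u + g m - g 1 - \<eta> * err_tail 0"
    using g_unbounded_below by blast
  have "l \<le> pmf (\<pi> k s) a" if a: "a \<in> opt_actions M s" for k a
  proof (rule g_le_cancel[OF l(1) policy_in])
    obtain b where b: "?u \<le> pmf (\<pi> k s) b" using ex_mass_ge_uniform by blast
    have "g ?u \<le> g (pmf (\<pi> k s) b)" using b u policy_in[of k s b] by (intro g_mono) auto
    moreover have "g m \<le> g (pmf (\<pi> 0 s) a)" using m m_le policy_in[of 0 s a] by (intro g_mono) auto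
    moreover have "g (pmf (\<pi> 0 s) b) \<le> g 1" using policy_in[of 0 s b] by (intro g_mono) auto
    moreover have "g (pmf (\<pi> 0 s) a) - g (pmf (\<pi> 0 s) b) - \<eta> * err_tail 0
        \<le> g (pmf (\<pi> k s) a) - g (pmf (\<pi> k s) b)"
      using opt_action_dpsi_gap[OF a, of 0 b k] by simp
    ultimately show "g l \<le> g (pmf (\<pi> k s) a)" using l(2) by linarith
  qed
  with l(1) show ?thesis by blast
qed

text \<open>The total mass of the optimal actions changes by as much as the suboptimal mass.\<close>

lemma opt_action_displacement:
  assumes l: "0 < l" and L: "0 < L" "\<And>z. z \<in> {l..1} \<Longrightarrow> L \<le> ddpsi \<psi> z"
    and ge: "\<And>b. b \<in> opt_actions M s \<Longrightarrow> l \<le> pmf (\<pi> k s) b"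
      "\<And>b. b \<in> opt_actions M s \<Longrightarrow> l \<le> pmf (\<pi> (k + n) s) b"
    and a: "a \<in> opt_actions M s"
  shows "\<bar>pmf (\<pi> k s) a - pmf (\<pi> (k + n) s) a\<bar>
    \<le> max (\<eta> * err_tail k / L) \<bar>subopt_mass M (\<pi> (k + n)) s - subopt_mass M (\<pi> k) s\<bar>"
proof -
  have "pmf (\<pi> k s) a - pmf (\<pi> (k + n) s) a \<le> max (\<eta> * err_tail k / L)
      \<bar>(\<Sum>b\<in>opt_actions M s. pmf (\<pi> k s) b) - (\<Sum>b\<in>opt_actions M s. pmf (\<pi> (k + n) s) b)\<bar>"
  proof (rule balanced_displacement_le[OF _ a l L])
    show "(g (pmf (\<pi> k s) a) - g (pmf (\<pi> (k + n) s) a)) - (g (pmf (\<pi> k s) b) - g (pmf (\<pi> (k + n) s) b))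
        \<le> \<eta> * err_tail k" if "b \<in> opt_actions M s" for b
      using opt_action_dpsi_gap[OF a, of k b n] by linarith
  qed (use ge in \<open>auto simp: pmf_le_1\<close>)
  moreover have "pmf (\<pi> (k + n) s) a - pmf (\<pi> k s) a \<le> max (\<eta> * err_tail k / L)
      \<bar>(\<Sum>b\<in>opt_actions M s. pmf (\<pi> (k + n) s) b) - (\<Sum>b\<in>opt_actions M s. pmf (\<pi> k s) b)\<bar>"
  proof (rule balanced_displacement_le[OF _ a l L])
    show "(g (pmf (\<pi> (k + n) s) a) - g (pmf (\<pi> k s) a)) - (g (pmf (\<pi> (k + n) s) b) - g (pmf (\<pi> k s) b))
        \<le> \<eta> * err_tail k" if "b \<in> opt_actions M s" for b
      using opt_action_dpsi_gap[OF that, of k a n] by linarith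
  qed (use ge in \<open>auto simp: pmf_le_1\<close>)
  ultimately show ?thesis by (simp add: sum_opt_actions abs_le_iff abs_minus_commute)
qed

lemma subopt_mass_tendsto: "(\<lambda>k. subopt_mass M (\<pi> k) s) \<longlonglongrightarrow> 0"
  by (rule summable_LIMSEQ_zero[OF summable_subopt_mass])

lemma policy_convergent: "convergent (\<lambda>k. pmf (\<pi> k s) a)"
proof (cases "a \<in> opt_actions M s")
  case False
  then show ?thesis using summable_LIMSEQ_zero[OF summable_suboptimal_action] convergentI by blast
next
  case True
  obtain l where l: "l \<in> {0<..1}" "\<And>k a. a \<in> opt_actions M s \<Longrightarrow> l \<le> pmf (\<pi> k s) a"
    using opt_action_mass_bounded_below by blast
  define L where "L = Inf (ddpsi \<psi> ` {l..1})"
  have L: "0 < L" "\<And>z. z \<in> {l..1} \<Longrightarrow> L \<le> ddpsi \<psi> z"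
    using curvature_bounds[OF l(1)] by (simp_all add: L_def)
  have "Cauchy (\<lambda>k. pmf (\<pi> k s) a)"
  proof (rule CauchyI')
    fix e :: real assume e: "0 < e"
    have "(\<lambda>k. \<eta> * err_tail k / L) \<longlonglongrightarrow> \<eta> * 0 / L"
      by (intro tendsto_intros err_tail_tendsto) (use L in simp)
    then have "\<forall>\<^sub>F k in sequentially. \<eta> * err_tail k / L < e"
      by (rule order_tendstoD) (use e in simp)
    moreover have "\<forall>\<^sub>F k in sequentially. subopt_mass M (\<pi> k) s < e"
      using subopt_mass_tendsto e by (rule order_tendstoD)
    ultimately obtain K where K: "\<And>k. K \<le> k \<Longrightarrow> \<eta> * err_tail k / L < e"
      "\<And>k. K \<le> k \<Longrightarrow> subopt_mass M (\<pi> k) s < e"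
      using eventually_conj unfolding eventually_sequentially by (metis (no_types, lifting) linorder_le_cases order_trans)
    show "\<exists>K. \<forall>m\<ge>K. \<forall>n>m. dist (pmf (\<pi> m s) a) (pmf (\<pi> n s) a) < e"
    proof (intro exI allI impI)
      fix m n assume mn: "K \<le> m" "m < n"
      then obtain j where n: "n = m + j" using less_imp_add_positive by blast
      have "\<bar>pmf (\<pi> m s) a - pmf (\<pi> n s) a\<bar>
          \<le> max (\<eta> * err_tail m / L) \<bar>subopt_mass M (\<pi> n) s - subopt_mass M (\<pi> m) s\<bar>"
        unfolding n using l(1) by (intro opt_action_displacement[OF _ L l(2) l(2) True]) auto
      also have "\<dots> < e"
        using K[of m] K(2)[of n] mn subopt_mass_bounds(1)[of "\<pi> m" s] subopt_mass_bounds(1)[of "\<pi> n" s]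
        by auto
      finally show "dist (pmf (\<pi> m s) a) (pmf (\<pi> n s) a) < e" by (simp add: dist_real_def)
    qed
  qed
  then show ?thesis by (rule Cauchy_convergent)
qed

lemma ex_limit_policy: "\<exists>\<pi>_inf :: ('s, 'a) policy. \<forall>s a. (\<lambda>k. pmf (\<pi> k s) a) \<longlonglongrightarrow> pmf (\<pi>_inf s) a"
proof -
  have "\<exists>p. \<forall>a. (\<lambda>k. pmf (\<pi> k s) a) \<longlonglongrightarrow> pmf p a" for s
  proof -
    define w where "w a = lim (\<lambda>k. pmf (\<pi> k s) a)" for a
    have w: "(\<lambda>k. pmf (\<pi> k s) a) \<longlonglongrightarrow> w a" for a
      unfolding w_def using policy_convergent by (simp add: convergent_LIMSEQ_iff)
    have "0 \<le> w a" for a by (rule LIMSEQ_le_const[OF w]) simp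
    moreover have "(\<lambda>k. \<Sum>a\<in>UNIV. pmf (\<pi> k s) a) \<longlonglongrightarrow> (\<Sum>a\<in>UNIV. w a)"
      by (intro tendsto_intros w)
    then have "(\<Sum>a\<in>UNIV. w a) = 1" by (simp add: sum_pmf_UNIV LIMSEQ_const_iff)
    ultimately obtain p where "\<forall>a. pmf p a = w a" using ex_pmf_of_weights[of w] by blast
    with w have "\<forall>a. (\<lambda>k. pmf (\<pi> k s) a) \<longlonglongrightarrow> pmf p a" by simp
    then show ?thesis by blast
  qed
  then show ?thesis by metis
qed

end

section \<open>Rates of convergence to the limiting policy\<close>

locale pmd_limit = pmd_run \<psi> M \<eta> \<pi>
  for \<psi> :: "real \<Rightarrow> ereal" and M :: "('s::finite, 'a::finite) mdp" and \<eta> :: real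
    and \<pi> :: "nat \<Rightarrow> ('s, 'a) policy" +
  fixes \<pi>_inf :: "('s, 'a) policy"
  assumes limit: "\<And>s a. (\<lambda>k. pmf (\<pi> k s) a) \<longlonglongrightarrow> pmf (\<pi>_inf s) a"
begin

lemma limit_suboptimal: "a \<notin> opt_actions M s \<Longrightarrow> pmf (\<pi>_inf s) a = 0"
  using LIMSEQ_unique[OF limit summable_LIMSEQ_zero[OF summable_suboptimal_action]] by blast

lemma set_pmf_limit: "set_pmf (\<pi>_inf s) = opt_actions M s"
proof (intro set_eqI iffI)
  fix a assume "a \<in> set_pmf (\<pi>_inf s)"
  then show "a \<in> opt_actions M s" using limit_suboptimal by (auto simp: set_pmf_iff)
next
  fix a assume a: "a \<in> opt_actions M s"
  obtain l where l: "l \<in> {0<..1}" "\<And>k. l \<le> pmf (\<pi> k s) a"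
    using opt_action_mass_bounded_below a by blast
  have "l \<le> pmf (\<pi>_inf s) a" by (rule LIMSEQ_le_const[OF limit]) (use l(2) in blast)
  then show "a \<in> set_pmf (\<pi>_inf s)" using l(1) by (auto simp: set_pmf_iff)
qed

lemma curvature_pos:
  "0 < least_curvature (\<pi>_inf s) (ddpsi \<psi>)"
  "least_curvature (\<pi>_inf s) (ddpsi \<psi>) \<le> greatest_curvature (\<pi>_inf s) (ddpsi \<psi>)"
  using curvature_bounds(1)[OF half_least_mass(1)[of "\<pi>_inf s"]]
    curvature_bounds(2,3)[OF half_least_mass(1)[of "\<pi>_inf s"], of 1] half_least_mass(1)[of "\<pi>_inf s"]
  unfolding least_curvature_def greatest_curvature_def by auto

text \<open>For optimal actions, let the later iterate in \<open>opt_action_displacement\<close> tend to the limit, where the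
  suboptimal mass is zero. For suboptimal actions the limit is zero and the suboptimal mass is a bound.\<close>

lemma distance_to_limit:
  "\<exists>K. \<forall>k\<ge>K. sup_norm (\<lambda>a. pmf (\<pi> k s) a - pmf (\<pi>_inf s) a) \<le>
     max (\<eta> * err_tail k / least_curvature (\<pi>_inf s) (ddpsi \<psi>)) (subopt_mass M (\<pi> k) s)"
proof -
  define l where "l = Min (pmf (\<pi>_inf s) ` set_pmf (\<pi>_inf s)) / 2"
  define L where "L = least_curvature (\<pi>_inf s) (ddpsi \<psi>)"
  have l: "l \<in> {0<..1}" unfolding l_def by (rule half_least_mass)
  have L: "0 < L" "\<And>z. z \<in> {l..1} \<Longrightarrow> L \<le> ddpsi \<psi> z"
    using curvature_bounds[OF l] by (simp_all add: L_def least_curvature_def l_def)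
  have "\<forall>\<^sub>F k in sequentially. \<forall>a\<in>opt_actions M s. l < pmf (\<pi> k s) a"
    using half_least_mass(2)[of _ "\<pi>_inf s"] unfolding set_pmf_limit l_def
    by (intro eventually_ball_finite ballI order_tendstoD(1)[OF limit]) auto
  then obtain K where K: "\<And>k a. K \<le> k \<Longrightarrow> a \<in> opt_actions M s \<Longrightarrow> l \<le> pmf (\<pi> k s) a"
    unfolding eventually_sequentially by (meson less_imp_le)
  have "\<bar>pmf (\<pi> k s) a - pmf (\<pi>_inf s) a\<bar> \<le> max (\<eta> * err_tail k / L) (subopt_mass M (\<pi> k) s)"
    if k: "K \<le> k" for k a
  proof (cases "a \<in> opt_actions M s")
    case True
    have "(\<lambda>n. \<bar>pmf (\<pi> k s) a - pmf (\<pi> (n + k) s) a\<bar>) \<longlonglongrightarrow> \<bar>pmf (\<pi> k s) a - pmf (\<pi>_inf s) a\<bar>"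
      by (intro tendsto_intros LIMSEQ_ignore_initial_segment limit)
    moreover have "(\<lambda>n. max (\<eta> * err_tail k / L) \<bar>subopt_mass M (\<pi> (n + k)) s - subopt_mass M (\<pi> k) s\<bar>)
        \<longlonglongrightarrow> max (\<eta> * err_tail k / L) \<bar>0 - subopt_mass M (\<pi> k) s\<bar>"
      by (intro tendsto_intros LIMSEQ_ignore_initial_segment[OF subopt_mass_tendsto])
    moreover have "\<bar>pmf (\<pi> k s) a - pmf (\<pi> (n + k) s) a\<bar>
        \<le> max (\<eta> * err_tail k / L) \<bar>subopt_mass M (\<pi> (n + k)) s - subopt_mass M (\<pi> k) s\<bar>" for n
      unfolding add.commute[of n k]
      by (rule opt_action_displacement[OF _ L _ _ True]) (use l K k in auto)
    ultimately have "\<bar>pmf (\<pi> k s) a - pmf (\<pi>_inf s) a\<bar>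
        \<le> max (\<eta> * err_tail k / L) \<bar>0 - subopt_mass M (\<pi> k) s\<bar>"
      by (intro LIMSEQ_le) auto
    then show ?thesis using subopt_mass_bounds(1)[of "\<pi> k" s] by simp
  next
    case False
    then show ?thesis using limit_suboptimal subopt_mass_bounds(2)[of a s "\<pi> k"] by simp
  qed
  then have "\<forall>k\<ge>K. sup_norm (\<lambda>a. pmf (\<pi> k s) a - pmf (\<pi>_inf s) a)
      \<le> max (\<eta> * err_tail k / L) (subopt_mass M (\<pi> k) s)"
    by (intro allI impI sup_norm_le)
  then show ?thesis unfolding L_def by blast
qed

text \<open>Both \<open>U / L\<close> and \<open>2 * U / L\<close> are at least \<open>1\<close>, so the maximum in \<open>distance_to_limit\<close> is at most the sum.\<close>

lemma multiple_optimal_rate: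
  fixes s :: 's
  defines "U \<equiv> greatest_curvature (\<pi>_inf s) (ddpsi \<psi>)" and "L \<equiv> least_curvature (\<pi>_inf s) (ddpsi \<psi>)"
  shows "\<exists>K. \<forall>k\<ge>K. sup_norm (\<lambda>a. pmf (\<pi> k s) a - pmf (\<pi>_inf s) a) \<le>
     U / L * subopt_mass M (\<pi> k) s + 2 * \<eta> * U / L\<^sup>2 * err_tail k"
proof -
  have LU: "0 < L" "L \<le> U" using curvature_pos[of s] by (simp_all add: U_def L_def)
  then have ratio: "1 \<le> U / L" by simp
  have "max (\<eta> * err_tail k / L) (subopt_mass M (\<pi> k) s)
      \<le> U / L * subopt_mass M (\<pi> k) s + 2 * \<eta> * U / L\<^sup>2 * err_tail k" for k
  proof -
    have tail: "0 \<le> \<eta> * err_tail k / L"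
      using eta_pos LU by (simp add: err_tail_def suminf_nonneg summable_err_tail V_err_nonneg)
    have "1 * (\<eta> * err_tail k / L) \<le> 2 * (U / L) * (\<eta> * err_tail k / L)"
      using ratio tail by (intro mult_right_mono) auto
    then have "\<eta> * err_tail k / L \<le> 2 * \<eta> * U / L\<^sup>2 * err_tail k"
      by (simp add: power2_eq_square mult_ac)
    moreover have "1 * subopt_mass M (\<pi> k) s \<le> U / L * subopt_mass M (\<pi> k) s"
      by (intro mult_right_mono ratio subopt_mass_bounds)
    ultimately show ?thesis using tail subopt_mass_bounds(1)[of "\<pi> k" s] by auto
  qed
  then show ?thesis using distance_to_limit[of s] unfolding L_def by (meson order_trans)
qed

text \<open>The limit puts all its mass on the only optimal action, and the iterate misses exactly the suboptimal mass there.\<close>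

lemma unique_optimal_distance:
  assumes "s \<in> S_eq1 M"
  shows "sup_norm (\<lambda>a. pmf (\<pi> k s) a - pmf (\<pi>_inf s) a) \<le> subopt_mass M (\<pi> k) s"
proof (rule sup_norm_le)
  fix a
  obtain b where b: "opt_actions M s = {b}" using assms by (auto simp: S_eq1_def card_1_singleton_iff)
  show "\<bar>pmf (\<pi> k s) a - pmf (\<pi>_inf s) a\<bar> \<le> subopt_mass M (\<pi> k) s"
  proof (cases "a = b")
    case True
    have "subopt_mass M \<pi>_inf s = 0" by (simp add: subopt_mass_def limit_suboptimal)
    then have "pmf (\<pi>_inf s) b = 1" using sum_opt_actions[where s = s and p = "\<pi>_inf"] b by simp
    moreover have "pmf (\<pi> k s) b = 1 - subopt_mass M (\<pi> k) s"
      using sum_opt_actions[where s = s and p = "\<pi> k"] b by simp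
    ultimately show ?thesis using True subopt_mass_bounds(1)[of "\<pi> k" s] by simp
  next
    case False
    then have "a \<notin> opt_actions M s" using b by simp
    then show ?thesis using limit_suboptimal subopt_mass_bounds(2)[of a s "\<pi> k"] by simp
  qed
qed

end

context pmd_run
begin

lemma gap_le:
  assumes "a \<notin> opt_actions M s"
  shows "gap M \<le> Vstar M s - Qstar M s a"
proof -
  have "s \<in> S_tilde M" using assms by (auto simp: S_tilde_def)
  then have "gap M \<le> gap_at M s" unfolding gap_def by (intro Min_le) auto
  also have "\<dots> \<le> Vstar M s - Qstar M s a"
    unfolding gap_at_def using assms by simp
  finally show ?thesis .
qed

text \<open>After \<open>T_iter M \<pi> \<sigma>\<close> the Q-values of optimal and suboptimal actions differ by at least \<open>gap M - 2 * \<sigma>\<close>, so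
  from then on each step widens the gap of \<open>\<psi>'\<close> by at least \<open>\<eta>\<close> times this amount; the constant \<open>C_at\<close> collects the gap at that time and \<open>\<psi>' 1\<close>.\<close>

lemma subopt_action_dpsi_le:
  assumes "0 < \<sigma>" "T_iter M \<pi> \<sigma> \<le> k" "a \<notin> opt_actions M s"
  shows "g (pmf (\<pi> k s) a) \<le> C_at M \<psi> \<eta> \<pi> \<sigma> s - real k * \<eta> * (gap M - 2 * \<sigma>)"
proof -
  let ?T = "T_iter M \<pi> \<sigma>"
  obtain n where k: "k = ?T + n" using assms(2) le_Suc_ex by blast
  obtain b where b: "b \<in> opt_actions M s" using opt_actions_nonempty by blast
  have "gap M - 2 * \<sigma> \<le> Q M (\<pi> (?T + t)) s b - Q M (\<pi> (?T + t)) s a" for t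
    using Q_ge[of s b "\<pi> (?T + t)"] Q_le_Qstar[of "\<pi> (?T + t)" s a] gap_le[OF assms(3)] b assms(1)
      V_err_le_after_T_iter[OF assms(1), of "?T + t"]
    by (simp add: opt_actions_def)
  then have "real n * (gap M - 2 * \<sigma>) \<le> (\<Sum>t<n. Q M (\<pi> (?T + t)) s b - Q M (\<pi> (?T + t)) s a)"
    using sum_bounded_below[of "{..<n}" "gap M - 2 * \<sigma>"
        "\<lambda>t. Q M (\<pi> (?T + t)) s b - Q M (\<pi> (?T + t)) s a"] by simp
  then have "\<eta> * (real n * (gap M - 2 * \<sigma>)) \<le> \<eta> * (\<Sum>t<n. Q M (\<pi> (?T + t)) s b - Q M (\<pi> (?T + t)) s a)"
    using eta_pos by (intro mult_left_mono) auto
  moreover have "G M \<psi> \<pi> ?T s \<le> g (pmf (\<pi> ?T s) b) - g (pmf (\<pi> ?T s) a)"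
    unfolding G_def by (intro diff_mono Min_le Max_ge) (use b assms(3) in auto)
  moreover have "g (pmf (\<pi> k s) b) \<le> g 1" using policy_in[of k s b] by (intro g_mono) auto
  ultimately show ?thesis
    using dpsi_diff_sum[of ?T n s b a]
    by (simp add: k C_at_def dpsi_1minus_eq algebra_simps)
qed

lemma subopt_mass_le_phi_inv:
  assumes \<sigma>: "0 < \<sigma>" and T1: "admissible_T1 M \<psi> \<eta> \<pi> \<sigma> T1" "T1 \<le> k" and s: "s \<in> S_tilde M"
  shows "subopt_mass M (\<pi> k) s \<le> real CARD('a) * phi_inv \<psi> (real k * \<eta> * (gap M - 2 * \<sigma>) - C1 M \<psi> \<eta> \<pi> \<sigma>)"
proof -
  let ?y = "real k * \<eta> * (gap M - 2 * \<sigma>) - C1 M \<psi> \<eta> \<pi> \<sigma>"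
  have "C1 M \<psi> \<eta> \<pi> \<sigma> \<in> C_at M \<psi> \<eta> \<pi> \<sigma> ` S_tilde M"
    unfolding C1_def by (rule Max_in) (use s in auto)
  then have y: "- g 1 \<le> ?y"
    using T1 by (auto simp: admissible_T1_def dpsi_1minus_eq)
  have "C_at M \<psi> \<eta> \<pi> \<sigma> s \<le> C1 M \<psi> \<eta> \<pi> \<sigma>"
    unfolding C1_def using s by simp
  then have "pmf (\<pi> k s) a \<le> phi_inv \<psi> ?y" if "a \<in> - opt_actions M s" for a
    using subopt_action_dpsi_le[OF \<sigma>, of k a s] T1 that
    by (intro le_phi_inv policy_in y) (auto simp: admissible_T1_def)
  then have "subopt_mass M (\<pi> k) s \<le> real (card (- opt_actions M s)) * phi_inv \<psi> ?y"
    unfolding subopt_mass_def using sum_bounded_above[of "- opt_actions M s" "pmf (\<pi> k s)"] by simp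
  also have "\<dots> \<le> real CARD('a) * phi_inv \<psi> ?y"
    using phi_inv_works(1)[OF y] by (intro mult_right_mono) (auto intro: card_mono)
  finally show ?thesis .
qed

text \<open>A state with a single optimal action could be outside \<open>S_tilde\<close> only if there were just one action; then
  that action would be optimal everywhere.\<close>

lemma S_eq1_subset_S_tilde:
  assumes "S_tilde M \<noteq> {}"
  shows "S_eq1 M \<subseteq> S_tilde M"
proof
  fix s assume "s \<in> S_eq1 M"
  then obtain b where b: "opt_actions M s = {b}" by (auto simp: S_eq1_def card_1_singleton_iff)
  show "s \<in> S_tilde M"
  proof (rule ccontr)
    assume "s \<notin> S_tilde M"
    then have "(UNIV :: 'a set) = {b}" using b by (simp add: S_tilde_def)
    then have "opt_actions M s' = UNIV" for s'
      using opt_actions_nonempty[of s'] subset_singletonD[of "opt_actions M s'" b] by auto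
    then show False using assms by (simp add: S_tilde_def)
  qed
qed

end

text \<open>The constants are the extreme values of \<open>\<psi>''\<close> on an interval that eventually contains the probabilities of
  all optimal actions.\<close>

theorem theorem3p9:
  shows "\<exists>U L :: 'a::finite pmf \<Rightarrow> (real \<Rightarrow> real) \<Rightarrow> real.
    \<forall>(M :: ('s::finite, 'a) mdp) (\<psi> :: real \<Rightarrow> ereal) (\<eta> :: real) (\<pi> :: nat \<Rightarrow> ('s, 'a) policy).
      valid_mdp M \<longrightarrow> S_tilde M \<noteq> {} \<longrightarrow>
      mirror_map \<psi> \<longrightarrow> \<eta> > 0 \<longrightarrow> pmd M \<psi> \<eta> \<pi> \<longrightarrow>
      dpsi_0plus \<psi> = -\<infinity> \<longrightarrow> dpsi_1minus \<psi> < \<infinity> \<longrightarrow>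
      (\<forall>x\<in>interior (edom \<psi>). dpsi \<psi> differentiable (at x)) \<longrightarrow>
      continuous_on (interior (edom \<psi>)) (ddpsi \<psi>) \<longrightarrow>
      (\<forall>x\<in>interior (edom \<psi>). 0 < ddpsi \<psi> x) \<longrightarrow>
      (\<exists>\<pi>_inf :: ('s, 'a) policy.
        (\<forall>s a. (\<lambda>k. pmf (\<pi> k s) a) \<longlonglongrightarrow> pmf (\<pi>_inf s) a) \<and>
        (\<forall>s\<in>S_eq1 M. \<forall>\<sigma>. 0 < \<sigma> \<and> \<sigma> < gap M / 2 \<longrightarrow>
          (\<forall>T1. admissible_T1 M \<psi> \<eta> \<pi> \<sigma> T1 \<longrightarrow>
            (\<forall>k\<ge>T1.
              sup_norm (\<lambda>a. pmf (\<pi> k s) a - pmf (\<pi>_inf s) a) \<le> subopt_mass M (\<pi> k) s \<and>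
              subopt_mass M (\<pi> k) s \<le>
                real CARD('a) * phi_inv \<psi> (real k * \<eta> * (gap M - 2 * \<sigma>) - C1 M \<psi> \<eta> \<pi> \<sigma>)))) \<and>
        (\<forall>s\<in>S_gt1 M.
          0 < U (\<pi>_inf s) (ddpsi \<psi>) \<and> 0 < L (\<pi>_inf s) (ddpsi \<psi>) \<and>
          (\<forall>\<sigma>. 0 < \<sigma> \<and> \<sigma> < gap M / 2 \<longrightarrow>
            (\<exists>T3. \<forall>k\<ge>T3.
              summable (\<lambda>t. V_err M (\<pi> (k + t))) \<and>
              sup_norm (\<lambda>a. pmf (\<pi> k s) a - pmf (\<pi>_inf s) a) \<le>
                U (\<pi>_inf s) (ddpsi \<psi>) / L (\<pi>_inf s) (ddpsi \<psi>) * subopt_mass M (\<pi> k) s +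
                2 * \<eta> * U (\<pi>_inf s) (ddpsi \<psi>) / (L (\<pi>_inf s) (ddpsi \<psi>))\<^sup>2 *
                  (\<Sum>t. V_err M (\<pi> (k + t)))))))"
proof (rule exI[of _ greatest_curvature], rule exI[of _ least_curvature], intro allI impI)
  fix M :: "('s, 'a) mdp" and \<psi> :: "real \<Rightarrow> ereal" and \<eta> :: real and \<pi> :: "nat \<Rightarrow> ('s, 'a) policy"
  assume valid: "valid_mdp M" and ne: "S_tilde M \<noteq> {}"
    and "mirror_map \<psi>" "\<eta> > 0" "pmd M \<psi> \<eta> \<pi>" "dpsi_0plus \<psi> = -\<infinity>" "dpsi_1minus \<psi> < \<infinity>"
      "\<forall>x\<in>interior (edom \<psi>). dpsi \<psi> differentiable (at x)"
      "continuous_on (interior (edom \<psi>)) (ddpsi \<psi>)"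
      "\<forall>x\<in>interior (edom \<psi>). 0 < ddpsi \<psi> x"
  then interpret pmd_run \<psi> M \<eta> \<pi> by unfold_locales auto
  obtain \<pi>_inf :: "('s, 'a) policy"
    where lim: "\<And>s a. (\<lambda>k. pmf (\<pi> k s) a) \<longlonglongrightarrow> pmf (\<pi>_inf s) a"
    using ex_limit_policy by blast
  interpret pmd_limit \<psi> M \<eta> \<pi> \<pi>_inf by unfold_locales (rule lim)
  let ?U = "greatest_curvature :: 'a pmf \<Rightarrow> (real \<Rightarrow> real) \<Rightarrow> real"
  let ?L = "least_curvature :: 'a pmf \<Rightarrow> (real \<Rightarrow> real) \<Rightarrow> real"
  show "\<exists>\<pi>_inf :: ('s, 'a) policy.
        (\<forall>s a. (\<lambda>k. pmf (\<pi> k s) a) \<longlonglongrightarrow> pmf (\<pi>_inf s) a) \<and>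
        (\<forall>s\<in>S_eq1 M. \<forall>\<sigma>. 0 < \<sigma> \<and> \<sigma> < gap M / 2 \<longrightarrow>
          (\<forall>T1. admissible_T1 M \<psi> \<eta> \<pi> \<sigma> T1 \<longrightarrow>
            (\<forall>k\<ge>T1.
              sup_norm (\<lambda>a. pmf (\<pi> k s) a - pmf (\<pi>_inf s) a) \<le> subopt_mass M (\<pi> k) s \<and>
              subopt_mass M (\<pi> k) s \<le>
                real CARD('a) * phi_inv \<psi> (real k * \<eta> * (gap M - 2 * \<sigma>) - C1 M \<psi> \<eta> \<pi> \<sigma>)))) \<and>
        (\<forall>s\<in>S_gt1 M.
          0 < ?U (\<pi>_inf s) (ddpsi \<psi>) \<and> 0 < ?L (\<pi>_inf s) (ddpsi \<psi>) \<and>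
          (\<forall>\<sigma>. 0 < \<sigma> \<and> \<sigma> < gap M / 2 \<longrightarrow>
            (\<exists>T3. \<forall>k\<ge>T3.
              summable (\<lambda>t. V_err M (\<pi> (k + t))) \<and>
              sup_norm (\<lambda>a. pmf (\<pi> k s) a - pmf (\<pi>_inf s) a) \<le>
                ?U (\<pi>_inf s) (ddpsi \<psi>) / ?L (\<pi>_inf s) (ddpsi \<psi>) * subopt_mass M (\<pi> k) s +
                2 * \<eta> * ?U (\<pi>_inf s) (ddpsi \<psi>) / (?L (\<pi>_inf s) (ddpsi \<psi>))\<^sup>2 *
                  (\<Sum>t. V_err M (\<pi> (k + t))))))"
  proof (intro exI[of _ \<pi>_inf] conjI ballI allI impI)
    show "(\<lambda>k. pmf (\<pi> k s) a) \<longlonglongrightarrow> pmf (\<pi>_inf s) a" for s a by (rule lim)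
  next
    fix s \<sigma> T1 k
    assume "s \<in> S_eq1 M" "0 < \<sigma> \<and> \<sigma> < gap M / 2" "admissible_T1 M \<psi> \<eta> \<pi> \<sigma> T1" "T1 \<le> k"
    then show "sup_norm (\<lambda>a. pmf (\<pi> k s) a - pmf (\<pi>_inf s) a) \<le> subopt_mass M (\<pi> k) s"
      "subopt_mass M (\<pi> k) s \<le>
        real CARD('a) * phi_inv \<psi> (real k * \<eta> * (gap M - 2 * \<sigma>) - C1 M \<psi> \<eta> \<pi> \<sigma>)"
      using unique_optimal_distance subopt_mass_le_phi_inv S_eq1_subset_S_tilde[OF ne] by blast+
  next
    fix s
    show "0 < ?U (\<pi>_inf s) (ddpsi \<psi>)" "0 < ?L (\<pi>_inf s) (ddpsi \<psi>)"
      using curvature_pos[of s] by linarith+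
  next
    fix s \<sigma>
    obtain K where "\<And>k. K \<le> k \<Longrightarrow> sup_norm (\<lambda>a. pmf (\<pi> k s) a - pmf (\<pi>_inf s) a) \<le>
        ?U (\<pi>_inf s) (ddpsi \<psi>) / ?L (\<pi>_inf s) (ddpsi \<psi>) * subopt_mass M (\<pi> k) s +
        2 * \<eta> * ?U (\<pi>_inf s) (ddpsi \<psi>) / (?L (\<pi>_inf s) (ddpsi \<psi>))\<^sup>2 * err_tail k"
      using multiple_optimal_rate[of s] by blast
    then show "\<exists>T3. \<forall>k\<ge>T3. summable (\<lambda>t. V_err M (\<pi> (k + t))) \<and>
        sup_norm (\<lambda>a. pmf (\<pi> k s) a - pmf (\<pi>_inf s) a) \<le>
          ?U (\<pi>_inf s) (ddpsi \<psi>) / ?L (\<pi>_inf s) (ddpsi \<psi>) * subopt_mass M (\<pi> k) s +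
          2 * \<eta> * ?U (\<pi>_inf s) (ddpsi \<psi>) / (?L (\<pi>_inf s) (ddpsi \<psi>))\<^sup>2 *
            (\<Sum>t. V_err M (\<pi> (k + t)))"
      using summable_err_tail unfolding err_tail_def by blast
  qed
qed

end
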